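(* For every integer $n\ge 2$, the marginal degree of sums in dimension $n$ satisfies $\sigma(n)=\left\lceil \frac{n}{2}\right\rceil$.
   Context: For a real-valued random variable $W$, put $W^+=\max\{W,0\}$ and $W^-=\max\{-W,0\}$. The extended expectation $\mathbb{E}W$ is said to be defined if at least one of $\mathbb{E}W^+$ and $\mathbb{E}W^-$ is finite; in that case $\mathbb{E}W:=\mathbb{E}W^+-\mathbb{E}W^-\in[-\infty,\infty]$. Write $[n]=\{1,\ldots,n\}$. Let $n\ge 2$. For $1\le k\le n$, say that the extended expectation of the sum is determined by $k$-marginals (in dimension $n$) if the following holds: whenever $X=(X_1,\ldots,X_n)$ and $Y=(Y_1,\ldots,Y_n)$ are random vectors in $\mathbb{R}^n$ (possibly on different probability spaces) such that $(X_i)_{i\in S}$ and $(Y_i)_{i\in S}$ have the same distribution for every $S\subseteq[n]$ with $|S|\le k$, and both $\mathbb{E}\sum_{i=1}^n X_i$ and $\mathbb{E}\sum_{i=1}^n Y_i$ are defined, then $\mathbb{E}\sum_{i=1}^n X_i=\mathbb{E}\sum_{i=1}^n Y_i$. The least such $k$ is called the marginal degree of sums in dimension $n$ and is denoted $\sigma(n)$. *)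

theory Defs
  imports "HOL-Probability.Probability"
begin

definition expectation_defined :: "'a measure \<Rightarrow> ('a \<Rightarrow> real) \<Rightarrow> bool" where
  "expectation_defined M W \<longleftrightarrow>
     (\<integral>\<^sup>+ \<omega>. ennreal (max (W \<omega>) 0) \<partial>M) < \<infinity> \<or> (\<integral>\<^sup>+ \<omega>. ennreal (max (- W \<omega>) 0) \<partial>M) < \<infinity>"

text \<open>Meaningful only under \<^const>\<open>expectation_defined\<close>.\<close>

definition extended_expectation :: "'a measure \<Rightarrow> ('a \<Rightarrow> real) \<Rightarrow> ereal" where
  "extended_expectation M W =
     enn2ereal (\<integral>\<^sup>+ \<omega>. ennreal (max (W \<omega>) 0) \<partial>M)
     - enn2ereal (\<integral>\<^sup>+ \<omega>. ennreal (max (- W \<omega>) 0) \<partial>M)"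

text \<open>A random vector in dimension \<open>n\<close> is a family \<open>X i\<close> of random variables, of which only the
  indices \<open>i \<in> {1..n}\<close> matter.\<close>

definition random_vector :: "nat \<Rightarrow> 'a measure \<Rightarrow> (nat \<Rightarrow> 'a \<Rightarrow> real) \<Rightarrow> bool" where
  "random_vector n M X \<longleftrightarrow> prob_space M \<and> (\<forall>i\<in>{1..n}. X i \<in> borel_measurable M)"

definition marginal :: "'a measure \<Rightarrow> (nat \<Rightarrow> 'a \<Rightarrow> real) \<Rightarrow> nat set \<Rightarrow> (nat \<Rightarrow> real) measure" where
  "marginal M X S = distr M (Pi\<^sub>M S (\<lambda>_. borel)) (\<lambda>\<omega>. \<lambda>i\<in>S. X i \<omega>)"

text \<open>A formula cannot quantify over types, so the two probability spaces are arbitrary ones whose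
  points are of type \<^typ>\<open>nat \<Rightarrow> real\<close>. Every random vector has a copy with the same law on such
  a space, so nothing is lost; see \<open>determined_by_marginalsD\<close> below, where the sample spaces have
  arbitrary types.\<close>

definition determined_by_marginals :: "nat \<Rightarrow> nat \<Rightarrow> bool" where
  "determined_by_marginals n k \<longleftrightarrow>
     (\<forall>(M :: (nat \<Rightarrow> real) measure) X (N :: (nat \<Rightarrow> real) measure) Y.
        random_vector n M X \<longrightarrow> random_vector n N Y \<longrightarrow>
        (\<forall>S. S \<subseteq> {1..n} \<longrightarrow> card S \<le> k \<longrightarrow> marginal M X S = marginal N Y S) \<longrightarrow>
        expectation_defined M (\<lambda>\<omega>. \<Sum>i=1..n. X i \<omega>) \<longrightarrow>
        expectation_defined N (\<lambda>\<omega>. \<Sum>i=1..n. Y i \<omega>) \<longrightarrow>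
        extended_expectation M (\<lambda>\<omega>. \<Sum>i=1..n. X i \<omega>) =
        extended_expectation N (\<lambda>\<omega>. \<Sum>i=1..n. Y i \<omega>))"

definition marginal_degree :: "nat \<Rightarrow> nat" where
  "marginal_degree n = (LEAST k. 1 \<le> k \<and> k \<le> n \<and> determined_by_marginals n k)"

lemma canonical_copy:
  assumes "random_vector n M X"
  defines "L \<equiv> marginal M X {1..n}" and "Z \<equiv> \<lambda>i x. x i"
  shows "random_vector n L Z"
    and "S \<subseteq> {1..n} \<Longrightarrow> marginal L Z S = marginal M X S"
    and "expectation_defined L (\<lambda>x. \<Sum>i=1..n. Z i x) = expectation_defined M (\<lambda>\<omega>. \<Sum>i=1..n. X i \<omega>)"
    and "extended_expectation L (\<lambda>x. \<Sum>i=1..n. Z i x) = extended_expectation M (\<lambda>\<omega>. \<Sum>i=1..n. X i \<omega>)"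
proof -
  let ?P = "Pi\<^sub>M {1..n} (\<lambda>_. borel :: real measure)"
  let ?R = "\<lambda>\<omega>. \<lambda>i\<in>{1..n}. X i \<omega>"
  interpret prob_space M using assms(1) by (simp add: random_vector_def)
  have R[measurable]: "?R \<in> measurable M ?P"
    using assms(1) by (intro measurable_restrict) (simp add: random_vector_def)
  have Z[measurable]: "(\<lambda>x. x i) \<in> borel_measurable ?P" if "i \<in> {1..n}" for i
    using that by (rule measurable_component_singleton)
  have L: "L = distr M ?P ?R" by (simp add: L_def marginal_def)
  show "random_vector n L Z"
    unfolding random_vector_def L Z_def using R by (auto intro!: prob_space_distr)
  show "marginal L Z S = marginal M X S" if S: "S \<subseteq> {1..n}"
  proof -
    have "(\<lambda>x. \<lambda>i\<in>S. x i) \<in> measurable ?P (Pi\<^sub>M S (\<lambda>_. borel))"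
      using S by (intro measurable_restrict Z) auto
    moreover have "(\<lambda>x. \<lambda>i\<in>S. x i) \<circ> ?R = (\<lambda>\<omega>. \<lambda>i\<in>S. X i \<omega>)"
      using S by (auto simp: fun_eq_iff)
    ultimately show ?thesis
      unfolding L Z_def marginal_def by (simp only: distr_distr[OF _ R])
  qed
  have S[measurable]: "(\<lambda>x. \<Sum>i=1..n. x i) \<in> borel_measurable ?P"
    by (intro borel_measurable_sum Z)
  have eq: "(\<Sum>i=1..n. ?R \<omega> i) = (\<Sum>i=1..n. X i \<omega>)" for \<omega>
    by (intro sum.cong) auto
  have pos: "(\<integral>\<^sup>+ x. ennreal (max (\<Sum>i=1..n. Z i x) 0) \<partial>L) =
      (\<integral>\<^sup>+ \<omega>. ennreal (max (\<Sum>i=1..n. X i \<omega>) 0) \<partial>M)"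
    unfolding L Z_def by (subst nn_integral_distr[OF R]) (simp_all only: measurable_distr_eq1 eq, use S in measurable)
  have neg: "(\<integral>\<^sup>+ x. ennreal (max (- (\<Sum>i=1..n. Z i x)) 0) \<partial>L) =
      (\<integral>\<^sup>+ \<omega>. ennreal (max (- (\<Sum>i=1..n. X i \<omega>)) 0) \<partial>M)"
    unfolding L Z_def by (subst nn_integral_distr[OF R]) (simp_all only: measurable_distr_eq1 eq, use S in measurable)
  show "expectation_defined L (\<lambda>x. \<Sum>i=1..n. Z i x) = expectation_defined M (\<lambda>\<omega>. \<Sum>i=1..n. X i \<omega>)"
    unfolding expectation_defined_def pos neg ..
  show "extended_expectation L (\<lambda>x. \<Sum>i=1..n. Z i x) = extended_expectation M (\<lambda>\<omega>. \<Sum>i=1..n. X i \<omega>)"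
    unfolding extended_expectation_def pos neg ..
qed

lemma determined_by_marginalsD:
  fixes M :: "'a measure" and N :: "'b measure"
  assumes "determined_by_marginals n k"
    and X: "random_vector n M X" and Y: "random_vector n N Y"
    and "\<And>S. S \<subseteq> {1..n} \<Longrightarrow> card S \<le> k \<Longrightarrow> marginal M X S = marginal N Y S"
    and "expectation_defined M (\<lambda>\<omega>. \<Sum>i=1..n. X i \<omega>)"
    and "expectation_defined N (\<lambda>\<omega>. \<Sum>i=1..n. Y i \<omega>)"
  shows "extended_expectation M (\<lambda>\<omega>. \<Sum>i=1..n. X i \<omega>) =
         extended_expectation N (\<lambda>\<omega>. \<Sum>i=1..n. Y i \<omega>)"
  unfolding canonical_copy(4)[OF X, symmetric] canonical_copy(4)[OF Y, symmetric]
proof (rule assms(1)[unfolded determined_by_marginals_def, rule_format])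
  show "marginal (marginal M X {1..n}) (\<lambda>i x. x i) S = marginal (marginal N Y {1..n}) (\<lambda>i x. x i) S"
    if "S \<subseteq> {1..n}" "card S \<le> k" for S
    using that assms(4) by (simp only: canonical_copy(2)[OF X] canonical_copy(2)[OF Y])
qed (simp_all only: canonical_copy(1,3)[OF X] canonical_copy(1,3)[OF Y] assms(5,6))

end

theory Submission
  imports Defs
begin

text \<open>
  Let \<open>k\<close> be half of \<open>n\<close>, rounded up.

  The marginals of size \<open>k\<close> suffice. Split the sum into two blocks of at most \<open>k\<close> coordinates, with
  sums \<open>U\<close> and \<open>V\<close>; the laws of \<open>U\<close> and \<open>V\<close> are known. Let \<open>clip t\<close> truncate a number to \<open>[- t, t]\<close>.
  Up to sign, \<open>clip t U + clip t V\<close> is the length of the part inside \<open>[- t, t]\<close> of the interval between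
  \<open>- V\<close> and \<open>U\<close>, so its positive and negative parts increase with \<open>t\<close> to those of \<open>U + V\<close>. By monotone
  convergence the expectation of \<open>U + V\<close>, if it is defined, is the limit of the expectations of
  \<open>clip t U + clip t V\<close>, and these depend on the two laws only
  (\<open>extended_expectation_sum_cong_distr\<close>).

  Smaller marginals do not suffice: let now \<open>k \<ge> 1\<close> and \<open>2 * k + 1 \<le> n\<close>. A signed measure \<open>\<tau>\<close> with
  vanishing \<open>k\<close>-marginals, for which the sum of the coordinates is integrable with nonzero integral,
  gives a counterexample: take its positive and negative parts as the laws of \<open>X\<close> and \<open>Y\<close>
  (\<open>not_determined_by_marginalsI\<close>). The measure \<open>\<tau>\<close> is glued from dilated copies of a finite pattern.
  The pattern (\<open>dilation_relation\<close>) consists of finite signed measures \<open>u\<close>, under which the sum has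
  integral 1, and \<open>h\<close>, supported on vectors of sum 0, such that \<open>h\<close> and \<open>2 u + D u\<close> have the same
  \<open>k\<close>-marginals, where \<open>D\<close> pushes forward under multiplication by \<open>- 2\<close>. Iterating
  \<open>u = h / 2 - D u / 2\<close>, an identity of \<open>k\<close>-marginals, expresses the \<open>k\<close>-marginals of \<open>u\<close> through an
  absolutely convergent series of dilates of \<open>h\<close> (\<open>dilation_series\<close>), and \<open>\<tau>\<close> is \<open>u\<close> minus that
  series. The series lives on vectors of sum 0, so the sum has integral 1 under \<open>\<tau>\<close>.

  To find the pattern, place the entries of an integer list at distinct random coordinates and fill up
  with zeros. It suffices to test against functions of at most \<open>k\<close> coordinates that vanish when one
  of these coordinates is 0 (\<open>finitary_vanishes\<close>). For them the average \<open>f xs\<close> over the placements of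
  \<open>xs\<close> is a polynomial of degree at most \<open>k\<close> in the multiset \<open>xs\<close> (\<open>scatter_centered\<close>,
  \<open>poly_deg_inj_sum\<close>). Two facts about such \<open>f\<close> produce \<open>h\<close>:

  \<^item> The value at \<open>xs\<close> is a linear combination of values at lists with the same sum and at most
    \<open>2 * k + 1\<close> entries (\<open>shorten_list\<close>): replacing two entries \<open>c\<close>, \<open>d\<close> by \<open>c + d\<close> shortens the
    list by one, at the cost of a difference that has lower degree in the remaining entries and uses
    two places. This is where \<open>2 * k + 1 \<le> n\<close> enters.

  \<^item> Differentiating \<open>f\<close> at the empty list is linear in the direction, so the derivative along
    ``twice the entry 1 and once the entry \<open>- 2\<close>'' is twice the derivative along 1 plus the
    derivative along \<open>- 2\<close> (\<open>weights_additive\<close>). Derivatives of polynomials of degree at most \<open>k\<close> are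
    combinations of values at \<open>0, \<dots>, k\<close>. The first derivative therefore combines lists of
    sum 0, with \<open>2 t\<close> entries 1 and \<open>t\<close> entries \<open>- 2\<close>, and gives \<open>h\<close> after shortening; the other two combine lists
    with at most \<open>k\<close> entries and give \<open>2 u\<close> and \<open>D u\<close>.
\<close>

section \<open>Sums of two random variables with known laws\<close>

lemma extended_expectation_integrable:
  assumes "integrable M W"
  shows "expectation_defined M W" "extended_expectation M W = ereal (\<integral>\<omega>. W \<omega> \<partial>M)"
proof -
  have pos: "ennreal (max r 0) = ennreal r" for r :: real
    by (cases "r \<ge> 0") (auto simp: ennreal_neg max_def)
  have fin: "(\<integral>\<^sup>+ \<omega>. ennreal (W \<omega>) \<partial>M) \<noteq> \<infinity>" "(\<integral>\<^sup>+ \<omega>. ennreal (- W \<omega>) \<partial>M) \<noteq> \<infinity>"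
    using assms by (auto simp: real_integrable_def)
  then show "expectation_defined M W"
    unfolding expectation_defined_def pos by (simp add: less_top)
  have "enn2ereal e = ereal (enn2real e)" if "e \<noteq> \<infinity>" for e
    using that by (cases e) (auto simp: enn2ereal_ennreal)
  then show "extended_expectation M W = ereal (\<integral>\<omega>. W \<omega> \<partial>M)"
    unfolding extended_expectation_def pos real_lebesgue_integral_def[OF assms] using fin by simp
qed

definition clip :: "real \<Rightarrow> real \<Rightarrow> real" where
  "clip t x = max (- t) (min t x)"

lemma abs_clip_le: "0 \<le> t \<Longrightarrow> \<bar>clip t x\<bar> \<le> t"
  by (auto simp: clip_def)

lemma clip_eq: "\<bar>x\<bar> \<le> t \<Longrightarrow> clip t x = x"
  by (auto simp: clip_def)

text \<open>
  Since \<open>clip s v = - clip s (- v)\<close>, the sum measures, with the sign of \<open>u + v\<close>, how much of the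
  interval between \<open>- v\<close> and \<open>u\<close> lies in \<open>[- s, s]\<close>; enlarging \<open>s\<close> can only increase this length.
\<close>

lemma clip_sum_mono:
  assumes "0 \<le> s" "s \<le> t"
  shows "max (clip s u + clip s v) 0 \<le> max (clip t u + clip t v) 0"
    and "max (- (clip s u + clip s v)) 0 \<le> max (- (clip t u + clip t v)) 0"
  using assms by (auto simp: clip_def max_def min_def)

lemma clip_measurable [measurable]: "clip t \<in> borel_measurable borel"
  unfolding clip_def by measurable

text \<open>
  Monotone convergence; \<open>G\<close> stands for the positive or the negative part.
\<close>

lemma nn_integral_clip_LIMSEQ:
  fixes G :: "real \<Rightarrow> ennreal"
  assumes [measurable]: "U \<in> borel_measurable M" "V \<in> borel_measurable M" "G \<in> borel_measurable borel"
    and mono: "\<And>s t u v. 0 \<le> s \<Longrightarrow> s \<le> t \<Longrightarrow> G (clip s u + clip s v) \<le> G (clip t u + clip t v)"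
  shows "(\<lambda>t. \<integral>\<^sup>+\<omega>. G (clip (real t) (U \<omega>) + clip (real t) (V \<omega>)) \<partial>M)
    \<longlonglongrightarrow> (\<integral>\<^sup>+\<omega>. G (U \<omega> + V \<omega>) \<partial>M)"
proof (rule nn_integral_LIMSEQ)
  show "incseq (\<lambda>t \<omega>. G (clip (real t) (U \<omega>) + clip (real t) (V \<omega>)))"
    by (auto simp: incseq_def le_fun_def intro: mono)
  show "(\<lambda>t. G (clip (real t) (U \<omega>) + clip (real t) (V \<omega>))) \<longlonglongrightarrow> G (U \<omega> + V \<omega>)" for \<omega>
  proof (rule tendsto_eventually)
    obtain T :: nat where T: "max \<bar>U \<omega>\<bar> \<bar>V \<omega>\<bar> \<le> real T" using real_arch_simple by blast
    have "clip (real t) (U \<omega>) = U \<omega>" "clip (real t) (V \<omega>) = V \<omega>" if "T \<le> t" for t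
    proof -
      have "real T \<le> real t" using that by simp
      then show "clip (real t) (U \<omega>) = U \<omega>" "clip (real t) (V \<omega>) = V \<omega>"
        using T by (intro clip_eq; linarith)+
    qed
    then show "\<forall>\<^sub>F t in sequentially. G (clip (real t) (U \<omega>) + clip (real t) (V \<omega>)) = G (U \<omega> + V \<omega>)"
      by (intro eventually_sequentiallyI[of T]) simp
  qed
qed measurable

text \<open>
  Both parts converge separately, and their limits are not both infinite because the expectation
  of the sum is defined, so the difference converges.
\<close>

lemma extended_expectation_clip_LIMSEQ:
  assumes [measurable]: "U \<in> borel_measurable M" "V \<in> borel_measurable M"
    and "expectation_defined M (\<lambda>\<omega>. U \<omega> + V \<omega>)"
  shows "(\<lambda>t. extended_expectation M (\<lambda>\<omega>. clip (real t) (U \<omega>) + clip (real t) (V \<omega>)))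
    \<longlonglongrightarrow> extended_expectation M (\<lambda>\<omega>. U \<omega> + V \<omega>)"
  unfolding extended_expectation_def
proof (intro tendsto_diff_ereal_general tendsto_enn2erealI)
  show "(\<lambda>t. \<integral>\<^sup>+\<omega>. ennreal (max (clip (real t) (U \<omega>) + clip (real t) (V \<omega>)) 0) \<partial>M)
    \<longlonglongrightarrow> (\<integral>\<^sup>+\<omega>. ennreal (max (U \<omega> + V \<omega>) 0) \<partial>M)"
    by (rule nn_integral_clip_LIMSEQ[where G = "\<lambda>x. ennreal (max x 0)"])
      (measurable, intro ennreal_leI clip_sum_mono)
  show "(\<lambda>t. \<integral>\<^sup>+\<omega>. ennreal (max (- (clip (real t) (U \<omega>) + clip (real t) (V \<omega>))) 0) \<partial>M)
    \<longlonglongrightarrow> (\<integral>\<^sup>+\<omega>. ennreal (max (- (U \<omega> + V \<omega>)) 0) \<partial>M)"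
    by (rule nn_integral_clip_LIMSEQ[where G = "\<lambda>x. ennreal (max (- x) 0)"])
      (measurable, intro ennreal_leI clip_sum_mono)
  have ninf: "enn2ereal e \<noteq> -\<infinity>" for e
    using enn2ereal_nonneg[of e] by auto
  have inf: "enn2ereal e = \<infinity> \<longleftrightarrow> e = \<infinity>" for e
    by (cases e) (auto simp: enn2ereal_ennreal)
  show "\<not> (enn2ereal (\<integral>\<^sup>+\<omega>. ennreal (max (U \<omega> + V \<omega>) 0) \<partial>M) = \<infinity> \<and>
      enn2ereal (\<integral>\<^sup>+\<omega>. ennreal (max (- (U \<omega> + V \<omega>)) 0) \<partial>M) = \<infinity> \<or>
      enn2ereal (\<integral>\<^sup>+\<omega>. ennreal (max (U \<omega> + V \<omega>) 0) \<partial>M) = - \<infinity> \<and>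
      enn2ereal (\<integral>\<^sup>+\<omega>. ennreal (max (- (U \<omega> + V \<omega>)) 0) \<partial>M) = - \<infinity>)"
    using assms(3) unfolding expectation_defined_def inf by (auto simp: ninf)
qed

lemma integrable_clip:
  assumes "prob_space M" and [measurable]: "U \<in> borel_measurable M"
  shows "integrable M (\<lambda>\<omega>. clip (real t) (U \<omega>))"
proof -
  interpret prob_space M by fact
  show ?thesis
    by (rule integrable_const_bound[where B = "real t"]) (auto simp: abs_clip_le)
qed

text \<open>
  For bounded truncations the expectation is additive and hence a function of the two laws,
  however the summands depend on each other; the truncation bound then goes to infinity.
\<close>

lemma extended_expectation_sum_cong_distr:
  assumes M: "prob_space M" and N: "prob_space N"
    and U: "U \<in> borel_measurable M" "U' \<in> borel_measurable N" "distr M borel U = distr N borel U'"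
    and V: "V \<in> borel_measurable M" "V' \<in> borel_measurable N" "distr M borel V = distr N borel V'"
    and def: "expectation_defined M (\<lambda>\<omega>. U \<omega> + V \<omega>)" "expectation_defined N (\<lambda>\<omega>. U' \<omega> + V' \<omega>)"
  shows "extended_expectation M (\<lambda>\<omega>. U \<omega> + V \<omega>) = extended_expectation N (\<lambda>\<omega>. U' \<omega> + V' \<omega>)"
proof -
  have same: "(\<integral>\<omega>. clip (real t) (W \<omega>) \<partial>M) = (\<integral>\<omega>. clip (real t) (W' \<omega>) \<partial>N)"
    if "W \<in> borel_measurable M" "W' \<in> borel_measurable N" "distr M borel W = distr N borel W'" for W W' t
    using integral_distr[OF that(1) clip_measurable] integral_distr[OF that(2) clip_measurable] that(3)
    by metis
  have "extended_expectation M (\<lambda>\<omega>. clip (real t) (U \<omega>) + clip (real t) (V \<omega>)) =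
      extended_expectation N (\<lambda>\<omega>. clip (real t) (U' \<omega>) + clip (real t) (V' \<omega>))" for t
    using integrable_clip[OF M U(1)] integrable_clip[OF M V(1)]
      integrable_clip[OF N U(2)] integrable_clip[OF N V(2)]
    by (simp add: extended_expectation_integrable same[OF U] same[OF V])
  then show ?thesis
    using extended_expectation_clip_LIMSEQ[OF U(1) V(1) def(1)]
      extended_expectation_clip_LIMSEQ[OF U(2) V(2) def(2)] LIMSEQ_unique by auto
qed

lemma distr_sum_cong_marginal:
  assumes "random_vector n M X" "random_vector n N Y" "S \<subseteq> {1..n}" "marginal M X S = marginal N Y S"
  shows "distr M borel (\<lambda>\<omega>. \<Sum>i\<in>S. X i \<omega>) = distr N borel (\<lambda>\<omega>. \<Sum>i\<in>S. Y i \<omega>)"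
proof -
  have add: "(\<lambda>x. \<Sum>i\<in>S. x i) \<in> borel_measurable (Pi\<^sub>M S (\<lambda>_. borel :: real measure))"
    by (intro borel_measurable_sum measurable_component_singleton)
  have "distr M borel (\<lambda>\<omega>. \<Sum>i\<in>S. X i \<omega>) = distr (marginal M X S) borel (\<lambda>x. \<Sum>i\<in>S. x i)"
    if "random_vector n M X" for M :: "'c measure" and X
  proof -
    have "(\<lambda>\<omega>. \<lambda>i\<in>S. X i \<omega>) \<in> measurable M (Pi\<^sub>M S (\<lambda>_. borel))"
      using that assms(3) by (intro measurable_restrict) (auto simp: random_vector_def)
    then show ?thesis
      unfolding marginal_def by (subst distr_distr[OF add]) (auto simp: o_def intro!: arg_cong[where f = "distr M borel"])
  qed
  from this[OF assms(1)] this[OF assms(2)] show ?thesis using assms(4) by simp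
qed

text \<open>
  Two blocks of at most \<open>k\<close> indices cover \<open>{1..n}\<close>, and a marginal determines the law of the sum of
  its block.
\<close>

lemma determined_by_half_marginals:
  assumes "n \<le> 2 * k"
  shows "determined_by_marginals n k"
  unfolding determined_by_marginals_def
proof (intro allI impI)
  fix M N :: "(nat \<Rightarrow> real) measure" and X Y
  assume X: "random_vector n M X" and Y: "random_vector n N Y"
    and marg: "\<forall>S\<subseteq>{1..n}. card S \<le> k \<longrightarrow> marginal M X S = marginal N Y S"
    and def: "expectation_defined M (\<lambda>\<omega>. \<Sum>i=1..n. X i \<omega>)" "expectation_defined N (\<lambda>\<omega>. \<Sum>i=1..n. Y i \<omega>)"
  define S T where "S = {1..min k n}" and "T = {min k n + 1..n}"
  have ST: "S \<subseteq> {1..n}" "T \<subseteq> {1..n}" "card S \<le> k" "card T \<le> k"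
    using assms by (auto simp: S_def T_def)
  have split: "(\<Sum>i=1..n. Z i \<omega>) = (\<Sum>i\<in>S. Z i \<omega>) + (\<Sum>i\<in>T. Z i \<omega>)" for Z :: "nat \<Rightarrow> (nat \<Rightarrow> real) \<Rightarrow> real" and \<omega>
  proof -
    have "{1..n} = S \<union> T" "S \<inter> T = {}" "finite S" "finite T" by (auto simp: S_def T_def)
    then show ?thesis by (simp add: sum.union_disjoint)
  qed
  have meas: "(\<lambda>\<omega>. \<Sum>i\<in>A. Z i \<omega>) \<in> borel_measurable L"
    if "random_vector n L Z" "A \<subseteq> {1..n}" for L Z and A :: "nat set"
    using that by (intro borel_measurable_sum) (auto simp: random_vector_def)
  show "extended_expectation M (\<lambda>\<omega>. \<Sum>i=1..n. X i \<omega>) = extended_expectation N (\<lambda>\<omega>. \<Sum>i=1..n. Y i \<omega>)"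
    unfolding split
  proof (rule extended_expectation_sum_cong_distr)
    show "prob_space M" "prob_space N" using X Y by (auto simp: random_vector_def)
    show "distr M borel (\<lambda>\<omega>. \<Sum>i\<in>S. X i \<omega>) = distr N borel (\<lambda>\<omega>. \<Sum>i\<in>S. Y i \<omega>)"
      using ST marg by (intro distr_sum_cong_marginal[OF X Y]) auto
    show "distr M borel (\<lambda>\<omega>. \<Sum>i\<in>T. X i \<omega>) = distr N borel (\<lambda>\<omega>. \<Sum>i\<in>T. Y i \<omega>)"
      using ST marg by (intro distr_sum_cong_marginal[OF X Y]) auto
    show "expectation_defined M (\<lambda>\<omega>. (\<Sum>i\<in>S. X i \<omega>) + (\<Sum>i\<in>T. X i \<omega>))"
      "expectation_defined N (\<lambda>\<omega>. (\<Sum>i\<in>S. Y i \<omega>) + (\<Sum>i\<in>T. Y i \<omega>))"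
      using def unfolding split .
  qed (intro meas X Y ST)+
qed

section \<open>Finitely supported signed measures\<close>

text \<open>
  A signed measure with finite support in \<open>A\<close>, viewed as the functional that integrates against it.
  The clauses are the ways in which such measures get combined below, so closure properties follow by
  rule induction without any bookkeeping of coefficients; \<open>finitary_atoms\<close> recovers the atoms.
\<close>

inductive finitary :: "'a set \<Rightarrow> (('a \<Rightarrow> real) \<Rightarrow> real) \<Rightarrow> bool" for A where
  eval: "x \<in> A \<Longrightarrow> finitary A (\<lambda>\<phi>. \<phi> x)"
| zero: "finitary A (\<lambda>_. 0)"
| plus: "finitary A l \<Longrightarrow> finitary A l' \<Longrightarrow> finitary A (\<lambda>\<phi>. l \<phi> + l' \<phi>)"
| scale: "finitary A l \<Longrightarrow> finitary A (\<lambda>\<phi>. c * l \<phi>)"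

lemma finitary_sum:
  assumes "\<And>i. i \<in> I \<Longrightarrow> finitary A (l i)"
  shows "finitary A (\<lambda>\<phi>. \<Sum>i\<in>I. l i \<phi>)"
  using assms by (induction I rule: infinite_finite_induct) (auto intro: finitary.intros)

lemma finitary_bind:
  assumes "finitary A l" "\<And>x. x \<in> A \<Longrightarrow> finitary B (L x)"
  shows "finitary B (\<lambda>\<phi>. l (\<lambda>x. L x \<phi>))"
  using assms by (induction rule: finitary.induct) (auto intro: finitary.intros)

lemma finitary_image:
  assumes "finitary A l" "\<And>x. x \<in> A \<Longrightarrow> F x \<in> B"
  shows "finitary B (\<lambda>\<phi>. l (\<lambda>x. \<phi> (F x)))"
  by (rule finitary_bind[OF assms(1), where L = "\<lambda>x \<phi>. \<phi> (F x)"])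
    (rule finitary.eval[OF assms(2)])

lemma finitary_mono: "finitary A l \<Longrightarrow> A \<subseteq> B \<Longrightarrow> finitary B l"
  using finitary_image[of A l "\<lambda>x. x" B] by auto

lemma finitary_cong:
  assumes "finitary A l" "\<And>x. x \<in> A \<Longrightarrow> \<phi> x = \<psi> x"
  shows "l \<phi> = l \<psi>"
  using assms by (induction rule: finitary.induct) auto

lemma finitary_lincomb:
  assumes "finitary A l"
  shows "l (\<lambda>x. a * \<phi> x + b * \<psi> x) = a * l \<phi> + b * l \<psi>"
  using assms by (induction rule: finitary.induct) (auto simp: algebra_simps)

lemma finitary_atoms:
  assumes "finitary A l"
  obtains ps where "set ps \<subseteq> UNIV \<times> A" "\<And>\<phi>. l \<phi> = (\<Sum>i<length ps. fst (ps ! i) * \<phi> (snd (ps ! i)))"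
proof -
  have "\<exists>ps. set ps \<subseteq> UNIV \<times> A \<and> (\<forall>\<phi>. l \<phi> = (\<Sum>p\<leftarrow>ps. fst p * \<phi> (snd p)))"
    using assms
  proof (induction rule: finitary.induct)
    case (eval x)
    then show ?case by (intro exI[of _ "[(1, x)]"]) auto
  next
    case zero
    show ?case by (intro exI[of _ "[]"]) auto
  next
    case (plus l l')
    from plus.IH obtain ps where ps:
      "set ps \<subseteq> UNIV \<times> A" "\<forall>\<phi>. l \<phi> = (\<Sum>p\<leftarrow>ps. fst p * \<phi> (snd p))" by (elim exE conjE)
    from plus.IH obtain ps' where ps':
      "set ps' \<subseteq> UNIV \<times> A" "\<forall>\<phi>. l' \<phi> = (\<Sum>p\<leftarrow>ps'. fst p * \<phi> (snd p))" by (elim exE conjE)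
    show ?case using ps ps' by (intro exI[of _ "ps @ ps'"]) simp
  next
    case (scale l c)
    from scale.IH obtain ps where ps:
      "set ps \<subseteq> UNIV \<times> A" "\<forall>\<phi>. l \<phi> = (\<Sum>p\<leftarrow>ps. fst p * \<phi> (snd p))" by (elim exE conjE)
    show ?case using ps
      by (intro exI[of _ "map (\<lambda>p. (c * fst p, snd p)) ps"])
        (auto simp: sum_list_const_mult[symmetric] o_def mult.assoc)
  qed
  then show ?thesis
    using that by (auto simp: sum_list_sum_nth atLeast0LessThan)
qed

section \<open>Polynomial functions of integer lists\<close>

definition cons_diff :: "int \<Rightarrow> (int list \<Rightarrow> real) \<Rightarrow> int list \<Rightarrow> real" where
  "cons_diff v f = (\<lambda>xs. f (v # xs) - f xs)"

text \<open>
  Degree in the sense of differences: \<open>k + 1\<close> successive differences vanish. Taking differences only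
  with respect to the first entry is enough, because all list operations below act at the head.
\<close>

fun poly_deg :: "nat \<Rightarrow> (int list \<Rightarrow> real) \<Rightarrow> bool" where
  "poly_deg 0 f \<longleftrightarrow> (\<exists>c. \<forall>xs. f xs = c)"
| "poly_deg (Suc k) f \<longleftrightarrow> (\<forall>v. poly_deg k (cons_diff v f))"

lemma poly_deg_zero: "poly_deg k (\<lambda>_. 0)"
  by (induction k) (auto simp: cons_diff_def)

lemma poly_deg_lincomb: "poly_deg k f \<Longrightarrow> poly_deg k g \<Longrightarrow> poly_deg k (\<lambda>xs. f xs + c * g xs)"
proof (induction k arbitrary: f g)
  case 0
  then show ?case by fastforce
next
  case (Suc k)
  show ?case
    unfolding poly_deg.simps
  proof
    fix v
    show "poly_deg k (cons_diff v (\<lambda>xs. f xs + c * g xs))"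
      using Suc.IH[of "cons_diff v f" "cons_diff v g"] Suc.prems by (simp add: cons_diff_def algebra_simps)
  qed
qed

lemma poly_deg_add: "poly_deg k f \<Longrightarrow> poly_deg k g \<Longrightarrow> poly_deg k (\<lambda>xs. f xs + g xs)"
  using poly_deg_lincomb[of k f g 1] by simp

lemma poly_deg_diff: "poly_deg k f \<Longrightarrow> poly_deg k g \<Longrightarrow> poly_deg k (\<lambda>xs. f xs - g xs)"
  using poly_deg_lincomb[of k f g "-1"] by simp

lemma poly_deg_sum:
  assumes "\<And>i. i \<in> I \<Longrightarrow> poly_deg k (f i)"
  shows "poly_deg k (\<lambda>xs. \<Sum>i\<in>I. f i xs)"
  using assms by (induction I rule: infinite_finite_induct) (auto simp: poly_deg_zero poly_deg_add)

lemma poly_deg_Suc: "poly_deg k f \<Longrightarrow> poly_deg (Suc k) f"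
proof (induction k arbitrary: f)
  case 0
  then show ?case by (fastforce simp: cons_diff_def)
next
  case (Suc k)
  then show ?case by (metis (no_types) poly_deg.simps(2))
qed

lemma poly_deg_Cons:
  assumes "poly_deg k f"
  shows "poly_deg k (\<lambda>xs. f (v # xs))"
proof (cases k)
  case 0
  then show ?thesis using assms by auto
next
  case (Suc k')
  then show ?thesis
    using poly_deg_add[OF assms poly_deg_Suc[of k' "cons_diff v f", folded Suc]] assms Suc
    by (simp add: cons_diff_def)
qed

text \<open>
  Writing \<open>\<Delta>\<close> for \<^const>\<open>cons_diff\<close>, the difference equals
  \<open>\<Delta> c f (d # xs) + \<Delta> d f xs - \<Delta> (c + d) f xs\<close>, a combination of first differences.
\<close>

lemma poly_deg_merge:
  assumes "poly_deg (Suc k) f"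
  shows "poly_deg k (\<lambda>xs. f (c # d # xs) - f ((c + d) # xs))"
proof -
  have D: "poly_deg k (cons_diff v f)" for v
    using assms by simp
  show ?thesis
    using poly_deg_add[OF poly_deg_Cons[OF D[of c], of d] poly_deg_diff[OF D[of d] D[of "c + d"]]]
    by (simp add: cons_diff_def)
qed

text \<open>
  Merging \<open>c\<close> and \<open>d\<close> keeps the sum and shortens the list. The error has degree one less as a
  function of the remaining entries, so by induction on the degree it is expressed through lists of at
  most \<open>2 * k - 1\<close> remaining entries; putting \<open>c, d\<close> or \<open>c + d\<close> back adds at most two.
\<close>

lemma shorten_list:
  "\<exists>l. finitary {ys. length ys \<le> 2 * k + 1 \<and> sum_list ys = sum_list xs} l \<and>
       (\<forall>f. poly_deg k f \<longrightarrow> l f = f xs)"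
proof (induction k arbitrary: xs)
  case 0
  show ?case
    by (rule exI[of _ "\<lambda>f. f [sum_list xs]"]) (auto intro: finitary.eval)
next
  case (Suc k)
  show ?case
  proof (induction xs rule: length_induct)
    case (1 xs)
    consider "length xs \<le> 1" | c d ys where "xs = c # d # ys"
      by (cases xs; cases "tl xs") auto
    then show ?case
    proof cases
      case 1
      then show ?thesis
        by (intro exI[of _ "\<lambda>f. f xs"]) (auto intro: finitary.eval)
    next
      case 2
      let ?A = "{zs. length zs \<le> 2 * Suc k + 1 \<and> sum_list zs = sum_list xs}"
      obtain l where l: "finitary ?A l" "\<And>f. poly_deg (Suc k) f \<Longrightarrow> l f = f ((c + d) # ys)"
        using "1.IH"[rule_format, of "(c + d) # ys"] 2 by (auto simp: add.assoc)
      obtain l' where l': "finitary {zs. length zs \<le> 2 * k + 1 \<and> sum_list zs = sum_list ys} l'"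
        "\<And>f. poly_deg k f \<Longrightarrow> l' f = f ys"
        using Suc.IH by blast
      let ?m = "\<lambda>f. l f + l' (\<lambda>zs. f (c # d # zs) - f ((c + d) # zs))"
      have "finitary ?A (\<lambda>f. l' (\<lambda>zs. f (c # d # zs) + (-1) * f ((c + d) # zs)))"
        by (rule finitary_bind[OF l'(1), where L = "\<lambda>zs f. f (c # d # zs) + (-1) * f ((c + d) # zs)"])
          (intro finitary.intros, auto simp: 2)
      then have "finitary ?A ?m"
        using l(1) by (intro finitary.plus) auto
      moreover have "?m f = f xs" if "poly_deg (Suc k) f" for f
        using l(2)[OF that] l'(2)[OF poly_deg_merge[OF that]] 2 by simp
      ultimately show ?thesis by blast
    qed
  qed
qed

text \<open>
  Newton's forward difference formula in the number of copies of \<open>v\<close>.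
\<close>

lemma newton_replicate:
  "poly_deg k f \<Longrightarrow>
    f (replicate a v @ ys) = (\<Sum>i\<le>k. real (a choose i) * (cons_diff v ^^ i) f ys)"
proof (induction a arbitrary: k f)
  case 0
  have "(\<Sum>i\<le>k. real (0 choose i) * (cons_diff v ^^ i) f ys) = (\<Sum>i\<in>{0}. (cons_diff v ^^ i) f ys)"
    by (rule sum.mono_neutral_cong_right) auto
  then show ?case by simp
next
  case (Suc a)
  note IH = Suc.IH[OF Suc.prems]
  show ?case
  proof (cases k)
    case 0
    then show ?thesis using Suc.prems by auto
  next
    case (Suc k')
    have "f (replicate (Suc a) v @ ys) =
        f (replicate a v @ ys) + cons_diff v f (replicate a v @ ys)" by (simp add: cons_diff_def)
    also have "cons_diff v f (replicate a v @ ys) =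
        (\<Sum>i\<le>k'. real (a choose i) * (cons_diff v ^^ Suc i) f ys)"
      using Suc.IH[of k' "cons_diff v f"] Suc.prems Suc
      by (simp add: funpow_Suc_right del: funpow.simps)
    also have "f (replicate a v @ ys) =
        f ys + (\<Sum>i\<le>k'. real (a choose Suc i) * (cons_diff v ^^ Suc i) f ys)"
      unfolding IH Suc sum.atMost_Suc_shift by simp
    finally show ?thesis
      unfolding Suc sum.atMost_Suc_shift by (simp add: algebra_simps sum.distrib)
  qed
qed

lemma poly_deg_funpow: "poly_deg k f \<Longrightarrow> i \<le> k \<Longrightarrow> poly_deg (k - i) ((cons_diff v ^^ i) f)"
proof (induction i)
  case (Suc i)
  then have "poly_deg (Suc (k - Suc i)) ((cons_diff v ^^ i) f)"
    by (simp add: Suc_diff_Suc)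
  then show ?case by simp
qed simp

section \<open>Derivatives as combinations of values\<close>

definition binom_poly :: "nat \<Rightarrow> real poly" where
  "binom_poly i = smult (1 / fact i) (\<Prod>j<i. [:- real j, 1:])"

lemma poly_binom_poly: "poly (binom_poly i) (real t) = real (t choose i)"
  unfolding binom_poly_def by (simp add: poly_prod binomial_gbinomial gbinomial_prod_rev atLeast0LessThan)

lemma degree_binom_poly: "degree (binom_poly i) = i"
  unfolding binom_poly_def by (simp add: degree_prod_eq_sum_degree)

text \<open>
  The \<open>k\<close>-th difference of a polynomial of degree less than \<open>k\<close> vanishes; one step of the induction
  passes to the first difference, whose degree is smaller.
\<close>

lemma alternating_binomial_sum_poly:
  fixes R :: "real poly"
  assumes "degree R < k"
  shows "(\<Sum>i\<le>k. (-1) ^ i * real (k choose i) * poly R (real i)) = 0"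
  using assms
proof (induction k arbitrary: R)
  case (Suc k)
  let ?D = "R \<circ>\<^sub>p [:1, 1:] - R"
  have D: "poly ?D (real i) = poly R (real (Suc i)) - poly R (real i)" for i
    by (simp add: poly_pcompose)
  have "(\<Sum>i\<le>Suc k. (-1) ^ i * real (Suc k choose i) * poly R (real i)) =
      poly R 0 + (\<Sum>i\<le>k. (-1) ^ Suc i * real (k choose Suc i) * poly R (real (Suc i)))
      - (\<Sum>i\<le>k. (-1) ^ i * real (k choose i) * poly R (real (Suc i)))"
    unfolding sum.atMost_Suc_shift by (simp add: algebra_simps sum.distrib sum_negf sum_subtractf)
  also have "poly R 0 + (\<Sum>i\<le>k. (-1) ^ Suc i * real (k choose Suc i) * poly R (real (Suc i))) =
      (\<Sum>i\<le>Suc k. (-1) ^ i * real (k choose i) * poly R (real i))"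
    unfolding sum.atMost_Suc_shift by simp
  also have "\<dots> = (\<Sum>i\<le>k. (-1) ^ i * real (k choose i) * poly R (real i))" by simp
  finally have eq: "(\<Sum>i\<le>Suc k. (-1) ^ i * real (Suc k choose i) * poly R (real i)) =
      - (\<Sum>i\<le>k. (-1) ^ i * real (k choose i) * poly ?D (real i))"
    unfolding D by (simp add: algebra_simps sum_subtractf)
  show ?case
  proof (cases "?D = 0")
    case True
    show ?thesis unfolding eq True by simp
  next
    case False
    have "degree ?D < degree R"
    proof (rule degree_less_if_less_eqI)
      show "degree ?D \<le> degree R" by (intro degree_diff_le) (auto simp: degree_pcompose)
      have "lead_coeff (R \<circ>\<^sub>p [:1, 1:]) = lead_coeff R" by (subst lead_coeff_comp) auto
      then show "coeff ?D (degree R) = 0" by (simp add: degree_pcompose)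
      show "?D \<noteq> 0" by (rule False)
    qed
    then have "degree ?D < k" using Suc.prems by simp
    then show ?thesis unfolding eq by (simp only: Suc.IH minus_zero)
  qed
qed simp

text \<open>
  Write \<open>Q = Q(0) + x R\<close>. The wanted coefficient is \<open>R(0)\<close>, and the vanishing \<open>k\<close>-th difference of
  \<open>R\<close> expresses it through the values \<open>R(t) = (Q(t) - Q(0)) / t\<close> for \<open>0 < t \<le> k\<close>.
\<close>

lemma differentiation_weights:
  obtains \<alpha> :: "nat \<Rightarrow> real" where
    "\<And>Q. degree Q \<le> k \<Longrightarrow> (\<Sum>t\<le>k. \<alpha> t * poly Q (real t)) = coeff Q 1"
proof -
  \<comment> \<open>The value at \<open>t = 0\<close> is 0 by the convention for division by zero.\<close>
  define \<beta> where "\<beta> t = (-1) ^ Suc t * real (k choose t) / real t" for t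
  have "(\<Sum>t\<le>k. \<beta> t * (poly Q (real t) - poly Q 0)) = coeff Q 1" if "degree Q \<le> k" for Q
  proof (cases Q)
    case (pCons a R)
    show ?thesis
    proof (cases "R = 0")
      case True
      then show ?thesis by (simp add: pCons)
    next
      case False
      then have "degree R < k" using that pCons by (simp add: degree_pCons_eq)
      then have "(\<Sum>t\<le>k. (-1) ^ t * real (k choose t) * poly R (real t)) = 0"
        by (rule alternating_binomial_sum_poly)
      moreover have "\<beta> t * (poly Q (real t) - poly Q 0) =
          (if t = 0 then poly R 0 else 0) - (-1) ^ t * real (k choose t) * poly R (real t)" for t
        by (simp add: \<beta>_def pCons)
      ultimately show ?thesis
        by (simp add: sum_subtractf pCons poly_0_coeff_0)
    qed
  qed
  note * = this
  \<comment> \<open>The weight at 0 collects the multiples of \<open>Q(0)\<close>.\<close>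
  have "(\<Sum>t\<le>k. (\<beta> t - (if t = 0 then sum \<beta> {..k} else 0)) * poly Q (real t)) = coeff Q 1"
    if "degree Q \<le> k" for Q
  proof -
    have "(\<Sum>t\<le>k. (if t = 0 then sum \<beta> {..k} else 0) * poly Q (real t)) =
        (\<Sum>t\<in>{0::nat}. sum \<beta> {..k} * poly Q 0)"
      by (rule sum.mono_neutral_cong_right) auto
    then show ?thesis
      using *[OF that]
      by (simp add: left_diff_distrib right_diff_distrib sum_subtractf sum_distrib_right)
  qed
  then show ?thesis by (rule that)
qed

text \<open>
  In the numbers \<open>a\<close> of copies of \<open>v\<close> and \<open>b\<close> of copies of \<open>w\<close>, \<open>f\<close> is a polynomial of total degree
  at most \<open>k\<close>. The weights differentiate it at \<open>(0, 0)\<close>, and the chain rule for \<open>t \<mapsto> (2 t, t)\<close> gives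
  the claim.
\<close>

lemma weights_additive:
  assumes \<alpha>: "\<And>Q. degree Q \<le> k \<Longrightarrow> (\<Sum>t\<le>k. \<alpha> t * poly Q (real t)) = coeff Q 1"
    and f: "poly_deg k f"
  shows "(\<Sum>t\<le>k. \<alpha> t * f (replicate (2 * t) v @ replicate t w)) =
    2 * (\<Sum>t\<le>k. \<alpha> t * f (replicate t v)) + (\<Sum>t\<le>k. \<alpha> t * f (replicate t w))"
proof -
  define J where "J = Sigma {..k} (\<lambda>i. {..k - i})"
  define e where "e = (\<lambda>(i, j). (cons_diff w ^^ j) ((cons_diff v ^^ i) f) [])"
  let ?A = "\<lambda>z. binom_poly (fst z)" and ?B = "\<lambda>z. binom_poly (snd z)"
  have fab: "f (replicate a v @ replicate b w) =
      (\<Sum>z\<in>J. e z * (poly (?A z) (real a) * poly (?B z) (real b)))" for a b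
  proof -
    have "f (replicate a v @ replicate b w) =
      (\<Sum>i\<le>k. real (a choose i) * (cons_diff v ^^ i) f (replicate b w @ []))"
      using newton_replicate[OF f] by simp
    also have "\<dots> = (\<Sum>i\<le>k. \<Sum>j\<le>k - i. e (i, j) * (real (a choose i) * real (b choose j)))"
      by (intro sum.cong refl, subst newton_replicate[OF poly_deg_funpow[OF f]])
        (auto simp: e_def sum_distrib_left algebra_simps)
    also have "\<dots> = (\<Sum>z\<in>J. e z * (poly (?A z) (real a) * poly (?B z) (real b)))"
      unfolding J_def by (subst sum.Sigma) (auto simp: poly_binom_poly split_def)
    finally show ?thesis .
  qed
  have deg: "degree (?A z) + degree (?B z) \<le> k" if "z \<in> J" for z
    using that by (auto simp: J_def degree_binom_poly)
  have eval: "(\<Sum>t\<le>k. \<alpha> t * (\<Sum>z\<in>J. e z * poly (P z) (real t))) = (\<Sum>z\<in>J. e z * coeff (P z) 1)"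
    if "\<And>z. z \<in> J \<Longrightarrow> degree (P z) \<le> k" for P
  proof -
    have "(\<Sum>t\<le>k. \<alpha> t * (\<Sum>z\<in>J. e z * poly (P z) (real t))) =
        (\<Sum>z\<in>J. e z * (\<Sum>t\<le>k. \<alpha> t * poly (P z) (real t)))"
      unfolding sum_distrib_left by (subst sum.swap) (simp add: mult.left_commute)
    then show ?thesis using \<alpha>[OF that] by simp
  qed
  \<comment> \<open>The terms of the restrictions of \<open>f\<close> to \<open>(2 t, t)\<close>, \<open>(t, 0)\<close> and \<open>(0, t)\<close>\<close>
  define PQ P Q where "PQ z = ?A z \<circ>\<^sub>p [:0, 2:] * ?B z"
    and "P z = smult (coeff (?B z) 0) (?A z)" and "Q z = smult (coeff (?A z) 0) (?B z)" for z
  have f: "f (replicate (2 * t) v @ replicate t w) = (\<Sum>z\<in>J. e z * poly (PQ z) (real t))"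
    "f (replicate t v) = (\<Sum>z\<in>J. e z * poly (P z) (real t))"
    "f (replicate t w) = (\<Sum>z\<in>J. e z * poly (Q z) (real t))" for t
    using fab[of "2 * t" t] fab[of t 0] fab[of 0 t]
    by (simp_all add: PQ_def P_def Q_def poly_pcompose poly_0_coeff_0 mult.commute)
  have degs: "degree (PQ z) \<le> k" "degree (P z) \<le> k" "degree (Q z) \<le> k" if "z \<in> J" for z
    using deg[OF that] degree_mult_le[of "?A z \<circ>\<^sub>p [:0, 2:]" "?B z"]
    by (auto simp: PQ_def P_def Q_def degree_pcompose)
  have "coeff (PQ z) 1 = 2 * coeff (P z) 1 + coeff (Q z) 1" for z
    by (simp add: PQ_def P_def Q_def coeff_mult coeff_pcompose_linear)
  then show ?thesis
    unfolding f by (simp only: eval degs) (simp add: algebra_simps sum.distrib sum_distrib_left)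
qed

section \<open>Random placements of a list\<close>

text \<open>
  The average of \<open>\<phi>\<close> over all ways to put the entries of the list at distinct coordinates in \<open>U\<close>, the
  other coordinates being 0.
\<close>

fun scatter :: "nat set \<Rightarrow> int list \<Rightarrow> ((nat \<Rightarrow> int) \<Rightarrow> real) \<Rightarrow> real" where
  "scatter U [] \<phi> = \<phi> (\<lambda>_. 0)"
| "scatter U (v # vs) \<phi> = (\<Sum>i\<in>U. scatter (U - {i}) vs (\<lambda>x. \<phi> (x(i := v)))) / real (card U)"

text \<open>
  The sum, over all injections of \<open>S\<close> into the positions of the list, of \<open>\<phi>\<close> at the vector whose
  coordinates in \<open>S\<close> are the chosen entries and whose other coordinates are 0. In contrast to an
  average over placements into \<open>U\<close>, this makes sense for lists of any length.
\<close>

fun inj_sum :: "nat set \<Rightarrow> ((nat \<Rightarrow> int) \<Rightarrow> real) \<Rightarrow> int list \<Rightarrow> real" where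
  "inj_sum S \<phi> [] = (if S = {} then \<phi> (\<lambda>_. 0) else 0)"
| "inj_sum S \<phi> (v # vs) = inj_sum S \<phi> vs + (\<Sum>i\<in>S. inj_sum (S - {i}) (\<lambda>x. \<phi> (x(i := v))) vs)"

definition depends_on :: "nat set \<Rightarrow> ((nat \<Rightarrow> int) \<Rightarrow> real) \<Rightarrow> bool" where
  "depends_on S \<phi> \<longleftrightarrow> (\<forall>x y. (\<forall>i\<in>S. x i = y i) \<longrightarrow> \<phi> x = \<phi> y)"

definition centered :: "nat set \<Rightarrow> ((nat \<Rightarrow> int) \<Rightarrow> real) \<Rightarrow> bool" where
  "centered S \<phi> \<longleftrightarrow> (\<forall>x. \<forall>i\<in>S. x i = 0 \<longrightarrow> \<phi> x = 0)"

lemma depends_on_upd: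
  assumes "depends_on S \<phi>" "S - {i} \<subseteq> T"
  shows "depends_on T (\<lambda>x. \<phi> (x(i := v)))"
  unfolding depends_on_def
proof (intro allI impI)
  fix x y :: "nat \<Rightarrow> int"
  assume "\<forall>j\<in>T. x j = y j"
  then have "\<forall>j\<in>S. (x(i := v)) j = (y(i := v)) j" using assms(2) by auto
  then show "\<phi> (x(i := v)) = \<phi> (y(i := v))"
    using assms(1) unfolding depends_on_def by blast
qed

lemma centered_upd:
  assumes "centered S \<phi>" "T \<subseteq> S - {i}"
  shows "centered T (\<lambda>x. \<phi> (x(i := v)))"
  unfolding centered_def
proof (intro allI ballI impI)
  fix x :: "nat \<Rightarrow> int" and j
  assume "j \<in> T" "x j = 0"
  then have "j \<in> S" "(x(i := v)) j = 0" using assms(2) by auto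
  then show "\<phi> (x(i := v)) = 0" using assms(1) unfolding centered_def by blast
qed

lemma depends_on_lincomb:
  assumes "depends_on S \<phi>" "depends_on S \<psi>"
  shows "depends_on S (\<lambda>x. \<phi> x + c * \<psi> x)"
  unfolding depends_on_def
proof (intro allI impI)
  fix x y :: "nat \<Rightarrow> int"
  assume "\<forall>j\<in>S. x j = y j"
  then have "\<phi> x = \<phi> y" "\<psi> x = \<psi> y" using assms unfolding depends_on_def by blast+
  then show "\<phi> x + c * \<psi> x = \<phi> y + c * \<psi> y" by simp
qed

lemma finitary_scatter:
  assumes "finite U" "length vs \<le> card U"
  shows "finitary {x. (\<Sum>i\<in>U. x i) = sum_list vs} (scatter U vs)"
  using assms
proof (induction vs arbitrary: U)
  case Nil
  have eq: "scatter U [] = (\<lambda>\<phi>. \<phi> (\<lambda>_. 0))" by (simp add: fun_eq_iff)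
  show ?case unfolding eq by (rule finitary.eval) simp
next
  case (Cons v vs)
  have "finitary {x. (\<Sum>j\<in>U. x j) = sum_list (v # vs)} (\<lambda>\<phi>. scatter (U - {i}) vs (\<lambda>x. \<phi> (x(i := v))))"
    if i: "i \<in> U" for i
  proof (rule finitary_image[OF Cons.IH])
    fix x :: "nat \<Rightarrow> int"
    assume "x \<in> {x. (\<Sum>j\<in>U - {i}. x j) = sum_list vs}"
    then show "x(i := v) \<in> {x. (\<Sum>j\<in>U. x j) = sum_list (v # vs)}"
      using Cons.prems i by (simp add: sum.remove)
  qed (use Cons.prems i in auto)
  then have "finitary {x. (\<Sum>j\<in>U. x j) = sum_list (v # vs)}
      (\<lambda>\<phi>. 1 / real (card U) * (\<Sum>i\<in>U. scatter (U - {i}) vs (\<lambda>x. \<phi> (x(i := v)))))"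
    by (intro finitary.scale finitary_sum)
  also have "(\<lambda>\<phi>. 1 / real (card U) * (\<Sum>i\<in>U. scatter (U - {i}) vs (\<lambda>x. \<phi> (x(i := v))))) = scatter U (v # vs)"
    by (simp add: fun_eq_iff)
  finally show ?case .
qed

lemma scatter_const:
  assumes "finite U" "length vs \<le> card U"
  shows "scatter U vs (\<lambda>_. c) = c"
  using assms
proof (induction vs arbitrary: U)
  case (Cons v vs)
  then have "scatter (U - {i}) vs (\<lambda>_. c) = c" if "i \<in> U" for i
    using that by auto
  then show ?case using Cons.prems by auto
qed simp

lemma scatter_sum:
  assumes "finite U" "length vs \<le> card U"
  shows "scatter U vs (\<lambda>x. real_of_int (\<Sum>i\<in>U. x i)) = real_of_int (sum_list vs)"
  using finitary_cong[OF finitary_scatter[OF assms], of "\<lambda>x. real_of_int (\<Sum>i\<in>U. x i)" "\<lambda>_. real_of_int (sum_list vs)"]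
    scatter_const[OF assms] by simp

lemma scatter_map:
  "scatter U (map ((*) c) vs) \<phi> = scatter U vs (\<lambda>x. \<phi> (\<lambda>i. c * x i))"
proof (induction vs arbitrary: U \<phi>)
  case (Cons v vs)
  have "(\<lambda>j. c * x j)(i := c * v) = (\<lambda>j. c * (x(i := v)) j)" for x and i :: nat by auto
  then show ?case by (simp only: list.map scatter.simps Cons.IH)
qed simp

lemma inj_sum_short:
  assumes "finite S" "length vs < card S"
  shows "inj_sum S \<phi> vs = 0"
  using assms by (induction vs arbitrary: S \<phi>) auto

text \<open>
  A new entry changes the sum by the injections that hit it. They leave one coordinate of \<open>S\<close> less
  to choose.
\<close>

lemma poly_deg_inj_sum:
  assumes "finite S" "card S \<le> k"
  shows "poly_deg k (inj_sum S \<phi>)"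
  using assms
proof (induction k arbitrary: S \<phi>)
  case 0
  then have "S = {}" by auto
  have "inj_sum {} \<phi> xs = \<phi> (\<lambda>_. 0)" for xs by (induction xs) auto
  then show ?case using \<open>S = {}\<close> by auto
next
  case (Suc k)
  have "cons_diff v (inj_sum S \<phi>) = (\<lambda>vs. \<Sum>i\<in>S. inj_sum (S - {i}) (\<lambda>x. \<phi> (x(i := v))) vs)" for v
    by (simp add: cons_diff_def fun_eq_iff)
  moreover have "poly_deg k (\<lambda>vs. \<Sum>i\<in>S. inj_sum (S - {i}) (\<lambda>x. \<phi> (x(i := v))) vs)" for v
    using Suc.prems by (intro poly_deg_sum Suc.IH) auto
  ultimately show ?case by simp
qed

text \<open>
  For centered \<open>\<phi>\<close> only those placements count that cover \<open>S\<close>, and such a placement amounts to an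
  injection of \<open>S\<close> into the list together with a placement of the remaining entries outside \<open>S\<close>.
\<close>

lemma scatter_centered:
  assumes "finite U" "length vs \<le> card U" "S \<subseteq> U" "depends_on S \<phi>" "centered S \<phi>"
  shows "fact (card U) * scatter U vs \<phi> = fact (card U - card S) * inj_sum S \<phi> vs"
  using assms
proof (induction vs arbitrary: U S \<phi>)
  case Nil
  then show ?case by (auto simp: centered_def)
next
  case (Cons v vs)
  define c m where "c = card U" and "m = card S"
  have fin: "finite S" using Cons.prems finite_subset by blast
  have c: "0 < c" "length vs \<le> c - 1" using Cons.prems by (auto simp: c_def)
  have "m \<le> c" unfolding c_def m_def using Cons.prems by (intro card_mono) auto
  \<comment> \<open>The first entry goes either to a coordinate in \<open>S\<close> or to one outside.\<close>
  have inside: "fact (c - 1) * scatter (U - {i}) vs (\<lambda>x. \<phi> (x(i := v))) =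
      fact (c - m) * inj_sum (S - {i}) (\<lambda>x. \<phi> (x(i := v))) vs" if i: "i \<in> S" for i
  proof -
    have iU: "i \<in> U" using i Cons.prems by auto
    have "0 < m" using i fin by (auto simp: m_def card_gt_0_iff)
    have "fact (card (U - {i})) * scatter (U - {i}) vs (\<lambda>x. \<phi> (x(i := v))) =
      fact (card (U - {i}) - card (S - {i})) * inj_sum (S - {i}) (\<lambda>x. \<phi> (x(i := v))) vs"
    proof (rule Cons.IH)
      show "depends_on (S - {i}) (\<lambda>x. \<phi> (x(i := v)))"
        using Cons.prems(4) by (rule depends_on_upd) auto
      show "centered (S - {i}) (\<lambda>x. \<phi> (x(i := v)))"
        using Cons.prems(5) by (rule centered_upd) auto
    qed (use Cons.prems c iU in \<open>auto simp: c_def\<close>)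
    moreover have "card (U - {i}) = c - 1" "card (S - {i}) = m - 1"
      using i iU fin Cons.prems by (auto simp: c_def m_def)
    ultimately show ?thesis using \<open>0 < m\<close> c by simp
  qed
  have outside: "fact (c - 1) * scatter (U - {i}) vs (\<lambda>x. \<phi> (x(i := v))) =
      fact (c - 1 - m) * inj_sum S \<phi> vs" if i: "i \<in> U - S" for i
  proof -
    have "\<phi> (x(i := v)) = \<phi> x" for x
      using Cons.prems(4) i unfolding depends_on_def by auto
    then have "(\<lambda>x. \<phi> (x(i := v))) = \<phi>" by blast
    moreover have "card (U - {i}) = c - 1" using i Cons.prems by (auto simp: c_def)
    moreover have "fact (card (U - {i})) * scatter (U - {i}) vs \<phi> =
      fact (card (U - {i}) - card S) * inj_sum S \<phi> vs"
      using Cons.prems i c by (intro Cons.IH) (auto simp: c_def)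
    ultimately show ?thesis by (simp add: m_def)
  qed
  have rest: "real (card (U - S)) * (fact (c - 1 - m) * inj_sum S \<phi> vs) = fact (c - m) * inj_sum S \<phi> vs"
  \<comment> \<open>If \<open>S = U\<close>, there is no place outside, and the remaining list is too short to cover \<open>S\<close>.\<close>
  proof (cases "m = c")
    case True
    then show ?thesis
      using c inj_sum_short[OF fin, of vs \<phi>] by (simp add: m_def)
  next
    case False
    then have "c - m = Suc (c - 1 - m)" using \<open>m \<le> c\<close> by simp
    moreover have "card (U - S) = c - m"
      using Cons.prems fin by (simp add: card_Diff_subset c_def m_def)
    ultimately show ?thesis by (simp add: algebra_simps)
  qed
  have "fact c * scatter U (v # vs) \<phi> = (\<Sum>i\<in>U. fact (c - 1) * scatter (U - {i}) vs (\<lambda>x. \<phi> (x(i := v))))"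
    using c by (simp add: c_def[symmetric] fact_reduce sum_distrib_left[symmetric])
  also have "\<dots> = (\<Sum>i\<in>S. fact (c - 1) * scatter (U - {i}) vs (\<lambda>x. \<phi> (x(i := v)))) +
      (\<Sum>i\<in>U - S. fact (c - 1) * scatter (U - {i}) vs (\<lambda>x. \<phi> (x(i := v))))"
    using Cons.prems by (simp add: sum.subset_diff[of S U] add.commute)
  also have "\<dots> = fact (c - m) * (\<Sum>i\<in>S. inj_sum (S - {i}) (\<lambda>x. \<phi> (x(i := v))) vs) +
      real (card (U - S)) * (fact (c - 1 - m) * inj_sum S \<phi> vs)"
    by (simp only: inside outside sum_distrib_left sum_constant cong: sum.cong)
  also have "\<dots> = fact (c - m) * inj_sum S \<phi> (v # vs)"
    unfolding rest by (simp add: algebra_simps)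
  finally show ?case unfolding c_def m_def .
qed

text \<open>
  Centered functions suffice as tests of a signed measure: a function is the sum of its restriction to
  \<open>x i = 0\<close>, which depends on one coordinate less, and the rest, which is centered in \<open>i\<close>. This is
  repeated for all coordinates in \<open>S\<close>.
\<close>

lemma finitary_vanishes:
  assumes E: "finitary A E"
    and centered: "\<And>C \<phi>. C \<subseteq> U \<Longrightarrow> card C \<le> k \<Longrightarrow> depends_on C \<phi> \<Longrightarrow> centered C \<phi> \<Longrightarrow> E \<phi> = 0"
    and S: "finite S" "S \<subseteq> U" "card S \<le> k" "depends_on S \<phi>"
  shows "E \<phi> = 0"
proof -
  have "E \<phi> = 0"
    if "finite T" "finite C" "C \<inter> T = {}" "C \<union> T \<subseteq> U" "card (C \<union> T) \<le> k" "depends_on (C \<union> T) \<phi>" "centered C \<phi>"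
    for T C \<phi>
    using that
  proof (induction T arbitrary: C \<phi> rule: finite_induct)
    case empty
    then show ?case using centered by simp
  next
    case (insert i T)
    define \<phi>0 where "\<phi>0 = (\<lambda>x. \<phi> (x(i := 0)))"
    have i: "i \<notin> C" using insert by auto
    have centered0: "centered C \<phi>0"
      unfolding \<phi>0_def using i by (intro centered_upd[OF insert.prems(6)]) auto
    have "E \<phi>0 = 0"
    proof (rule insert.IH)
      show "depends_on (C \<union> T) \<phi>0"
        unfolding \<phi>0_def by (rule depends_on_upd[OF insert.prems(5)]) auto
      show "centered C \<phi>0" by (rule centered0)
      have "card (C \<union> T) \<le> card (C \<union> insert i T)" using insert by (intro card_mono) auto
      then show "card (C \<union> T) \<le> k" using insert by simp
    qed (use insert in auto)
    moreover have "E (\<lambda>x. \<phi> x + (-1) * \<phi>0 x) = 0"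
    proof (rule insert.IH)
      have "depends_on (C \<union> insert i T) \<phi>0"
        unfolding \<phi>0_def by (rule depends_on_upd[OF insert.prems(5)]) auto
      then show "depends_on (insert i C \<union> T) (\<lambda>x. \<phi> x + (-1) * \<phi>0 x)"
        using depends_on_lincomb[OF insert.prems(5), of \<phi>0 "-1"] by simp
      show "centered (insert i C) (\<lambda>x. \<phi> x + (-1) * \<phi>0 x)"
        unfolding centered_def
      proof (intro allI ballI impI)
        fix x :: "nat \<Rightarrow> int" and j
        assume "j \<in> insert i C" "x j = 0"
        then have "\<phi> x = \<phi>0 x \<or> \<phi> x = 0 \<and> \<phi>0 x = 0"
          using insert.prems(6) centered0 fun_upd_triv[of x i] unfolding centered_def \<phi>0_def by (metis insertE)
        then show "\<phi> x + (-1) * \<phi>0 x = 0" by auto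
      qed
    qed (use insert in auto)
    ultimately show ?case
      using finitary_lincomb[OF E, of 1 \<phi> "-1" \<phi>0] by simp
  qed
  from this[of S "{}" \<phi>] show ?thesis using S by (simp add: centered_def)
qed

section \<open>The self-similar pattern\<close>

text \<open>
  The functional \<open>u\<close> is the derivative at the empty list along the entry 1. Dilation by \<open>- 2\<close> turns it
  into the derivative along the entry \<open>- 2\<close>. The factor \<open>- 2\<close> is chosen because two entries 1 and one
  entry \<open>- 2\<close> add up to 0; a factor of absolute value greater than 1 makes the series below converge.
\<close>

lemma dilation_relation:
  assumes U: "finite U" "2 * k + 1 \<le> card U" and k: "1 \<le> k"
  obtains u h where
    "finitary UNIV u" "finitary {x. (\<Sum>i\<in>U. x i) = 0} h"
    "u (\<lambda>x. real_of_int (\<Sum>i\<in>U. x i)) = 1"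
    "\<And>S \<phi>. S \<subseteq> U \<Longrightarrow> card S \<le> k \<Longrightarrow> depends_on S \<phi> \<Longrightarrow>
       h \<phi> = 2 * u \<phi> + u (\<lambda>x. \<phi> (\<lambda>i. - 2 * x i))"
proof -
  obtain \<alpha> :: "nat \<Rightarrow> real" where
    \<alpha>: "\<And>Q. degree Q \<le> k \<Longrightarrow> (\<Sum>t\<le>k. \<alpha> t * poly Q (real t)) = coeff Q 1"
    by (rule differentiation_weights[of k]) (rule that)
  have "\<forall>t. \<exists>l. finitary {ys. length ys \<le> 2 * k + 1 \<and> sum_list ys = 0} l \<and>
       (\<forall>f. poly_deg k f \<longrightarrow> l f = f (replicate (2 * t) 1 @ replicate t (-2)))"
    using shorten_list[of k "replicate (2 * t) 1 @ replicate t (-2)" for t]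
    by (simp add: sum_list_replicate)
  then obtain l where l: "\<And>t. finitary {ys. length ys \<le> 2 * k + 1 \<and> sum_list ys = 0} (l t)"
    "\<And>t f. poly_deg k f \<Longrightarrow> l t f = f (replicate (2 * t) 1 @ replicate t (-2))"
    by metis
  define u where "u \<phi> = (\<Sum>t\<le>k. \<alpha> t * scatter U (replicate t 1) \<phi>)" for \<phi>
  define h where "h \<phi> = (\<Sum>t\<le>k. \<alpha> t * l t (\<lambda>vs. scatter U vs \<phi>))" for \<phi>
  have dil: "u (\<lambda>x. \<phi> (\<lambda>i. - 2 * x i)) = (\<Sum>t\<le>k. \<alpha> t * scatter U (replicate t (-2)) \<phi>)" for \<phi>
    unfolding u_def using scatter_map[of U "-2" "replicate t 1" \<phi> for t] by simp
  have fin_u: "finitary UNIV u"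
    unfolding u_def using U
    by (intro finitary_sum finitary.scale finitary_mono[OF finitary_scatter]) auto
  have fin_h: "finitary {x. (\<Sum>i\<in>U. x i) = 0} h"
    unfolding h_def
  proof (intro finitary_sum finitary.scale)
    show "finitary {x. (\<Sum>i\<in>U. x i) = 0} (\<lambda>\<phi>. l t (\<lambda>vs. scatter U vs \<phi>))" for t
      using U by (intro finitary_bind[OF l(1)] finitary_mono[OF finitary_scatter]) auto
  qed
  \<comment> \<open>The defect of the relation is again a finite signed measure, so centered tests suffice.\<close>
  define E where "E \<phi> = h \<phi> + (-1) * (2 * u \<phi> + u (\<lambda>x. \<phi> (\<lambda>i. - 2 * x i)))" for \<phi>
  have fin_E: "finitary UNIV E"
    unfolding E_def
    by (intro finitary.plus finitary.scale fin_u finitary_mono[OF fin_h] finitary_image[OF fin_u]) auto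
  have E0: "E \<phi> = 0" if C: "C \<subseteq> U" "card C \<le> k" "depends_on C \<phi>" "centered C \<phi>" for C \<phi>
  proof -
    define r :: real where "r = fact (card U - card C) / fact (card U)"
    define f where "f = inj_sum C \<phi>"
    have f: "poly_deg k f"
      unfolding f_def using C U by (intro poly_deg_inj_sum) (auto intro: finite_subset)
    have sc: "scatter U vs \<phi> = r * f vs" if "length vs \<le> 2 * k + 1" for vs
      using scatter_centered[OF U(1) _ C(1,3,4), of vs] that U
      by (simp add: r_def f_def field_simps)
    have "l t (\<lambda>vs. scatter U vs \<phi>) = r * f (replicate (2 * t) 1 @ replicate t (-2))" for t
    proof -
      have "l t (\<lambda>vs. scatter U vs \<phi>) = l t (\<lambda>vs. r * f vs + 0 * f vs)"
        by (rule finitary_cong[OF l(1)]) (simp add: sc)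
      also have "\<dots> = r * l t f" by (subst finitary_lincomb[OF l(1)]) simp
      finally show ?thesis by (simp add: l(2)[OF f])
    qed
    then have "h \<phi> = r * (\<Sum>t\<le>k. \<alpha> t * f (replicate (2 * t) 1 @ replicate t (-2)))"
      by (simp add: h_def sum_distrib_left mult.left_commute)
    moreover have "u \<phi> = r * (\<Sum>t\<le>k. \<alpha> t * f (replicate t 1))"
      by (simp add: u_def sum_distrib_left mult.left_commute sc)
    moreover have "u (\<lambda>x. \<phi> (\<lambda>i. - 2 * x i)) = r * (\<Sum>t\<le>k. \<alpha> t * f (replicate t (-2)))"
      unfolding dil by (simp add: sum_distrib_left mult.left_commute sc)
    ultimately show ?thesis
      using weights_additive[OF \<alpha> f, of 1 "-2"] by (simp add: E_def algebra_simps)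
  qed
  have "u (\<lambda>x. real_of_int (\<Sum>i\<in>U. x i)) = (\<Sum>t\<le>k. \<alpha> t * poly [:0, 1:] (real t))"
    unfolding u_def using U by (intro sum.cong refl) (subst scatter_sum, auto simp: sum_list_replicate)
  also have "\<dots> = 1" using k by (subst \<alpha>) auto
  finally have "u (\<lambda>x. real_of_int (\<Sum>i\<in>U. x i)) = 1" .
  moreover have "h \<phi> = 2 * u \<phi> + u (\<lambda>x. \<phi> (\<lambda>i. - 2 * x i))"
    if "S \<subseteq> U" "card S \<le> k" "depends_on S \<phi>" for S \<phi>
  proof -
    have "finite S" using that(1) U(1) by (rule finite_subset)
    have "E \<phi> = 0"
    proof (rule finitary_vanishes[OF fin_E])
      show "E \<psi> = 0" if "C \<subseteq> U" "card C \<le> k" "depends_on C \<psi>" "centered C \<psi>" for C \<psi>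
        using that by (rule E0)
    qed (fact \<open>finite S\<close> that)+
    then show ?thesis by (simp add: E_def)
  qed
  ultimately show ?thesis using fin_u fin_h that by blast
qed

text \<open>
  Solving the relation for \<open>u\<close> and iterating leaves the remainder \<open>(- 1/2) ^ J * u (\<phi> \<circ> (- 2) ^ J)\<close>,
  which tends to 0 because \<open>\<phi>\<close> is bounded.
\<close>

lemma dilation_series:
  fixes u h :: "((nat \<Rightarrow> int) \<Rightarrow> real) \<Rightarrow> real"
  assumes rel: "\<And>\<phi>. depends_on S \<phi> \<Longrightarrow> h \<phi> = 2 * u \<phi> + u (\<lambda>x. \<phi> (\<lambda>i. - 2 * x i))"
    and bound: "\<And>\<phi>. (\<And>x. \<bar>\<phi> x\<bar> \<le> 1) \<Longrightarrow> \<bar>u \<phi>\<bar> \<le> C"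
    and \<phi>: "depends_on S \<phi>" "\<And>x. \<bar>\<phi> x\<bar> \<le> 1"
  shows "(\<lambda>j. 1/2 * (- 1/2) ^ j * h (\<lambda>x. \<phi> (\<lambda>i. (- 2) ^ j * x i))) sums u \<phi>"
proof -
  let ?\<phi> = "\<lambda>j x. \<phi> (\<lambda>i. (- 2) ^ j * x i)"
  have step: "h (?\<phi> j) = 2 * u (?\<phi> j) + u (?\<phi> (Suc j))" for j
  proof -
    have "depends_on S (?\<phi> j)"
      using \<phi>(1) unfolding depends_on_def by simp
    from rel[OF this] show ?thesis by (simp add: mult.assoc mult.left_commute)
  qed
  have partial: "(\<Sum>j<J. 1/2 * (- 1/2) ^ j * h (?\<phi> j)) = u \<phi> - (- 1/2) ^ J * u (?\<phi> J)" for J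
  proof (induction J)
    case (Suc J)
    have "(\<Sum>j<Suc J. 1/2 * (- 1/2) ^ j * h (?\<phi> j)) =
        u \<phi> - (- 1/2) ^ J * u (?\<phi> J) + 1/2 * (- 1/2) ^ J * (2 * u (?\<phi> J) + u (?\<phi> (Suc J)))"
      unfolding sum.lessThan_Suc Suc.IH step[of J] ..
    also have "\<dots> = u \<phi> - (- 1/2) ^ Suc J * u (?\<phi> (Suc J))"
      unfolding power_Suc by algebra
    finally show ?case .
  qed simp
  have "(\<lambda>J. (- 1/2) ^ J * u (?\<phi> J)) \<longlonglongrightarrow> 0"
  proof (rule Lim_null_comparison)
    show "\<forall>\<^sub>F J in sequentially. norm ((- 1/2) ^ J * u (?\<phi> J)) \<le> (1/2) ^ J * C"
      using bound[of "?\<phi> J" for J] \<phi>(2)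
      by (intro always_eventually allI) (auto simp: abs_mult power_abs intro!: mult_left_mono)
    show "(\<lambda>J. (1/2) ^ J * C) \<longlonglongrightarrow> 0"
      by (intro tendsto_mult_left_zero LIMSEQ_power_zero) auto
  qed
  then have "(\<lambda>J. u \<phi> - (- 1/2) ^ J * u (?\<phi> J)) \<longlonglongrightarrow> u \<phi> - 0"
    by (intro tendsto_intros)
  then show ?thesis unfolding sums_def partial by simp
qed

section \<open>From signed measures to random vectors\<close>

text \<open>
  The signed measure with density \<open>c\<close> has total mass 0, so its positive and negative parts have the
  same mass \<open>m\<close>. Divided by \<open>m\<close> they become two laws for \<open>Z\<close> that have the same \<open>k\<close>-marginals but
  different expectations of the sum.
\<close>

lemma not_determined_by_marginalsI:
  fixes R :: "'a measure" and c :: "'a \<Rightarrow> real" and Z :: "nat \<Rightarrow> 'a \<Rightarrow> real"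
  assumes c: "integrable R c"
    and Z: "\<And>i. i \<in> {1..n} \<Longrightarrow> Z i \<in> borel_measurable R"
    and null: "\<And>S B. S \<subseteq> {1..n} \<Longrightarrow> card S \<le> k \<Longrightarrow> B \<in> sets (Pi\<^sub>M S (\<lambda>_. borel)) \<Longrightarrow>
      (\<integral>\<omega>. c \<omega> * indicator B (\<lambda>i\<in>S. Z i \<omega>) \<partial>R) = 0"
    and int: "integrable R (\<lambda>\<omega>. c \<omega> * (\<Sum>i=1..n. Z i \<omega>))"
    and nonzero: "(\<integral>\<omega>. c \<omega> * (\<Sum>i=1..n. Z i \<omega>) \<partial>R) \<noteq> 0"
  shows "\<not> determined_by_marginals n k"
proof
  assume det: "determined_by_marginals n k"
  note [measurable] = borel_measurable_integrable[OF c] Z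
  define s where "s \<omega> = (\<Sum>i=1..n. Z i \<omega>)" for \<omega>
  have s[measurable]: "s \<in> borel_measurable R"
    unfolding s_def by (intro borel_measurable_sum Z) auto
  define m where "m = (\<integral>\<omega>. max (c \<omega>) 0 \<partial>R)"
  \<comment> \<open>The densities of the two laws, for \<open>\<sigma> = 1\<close> and \<open>\<sigma> = - 1\<close>\<close>
  define p where "p \<sigma> \<omega> = max (\<sigma> * c \<omega>) 0 / m" for \<sigma> \<omega>
  have p[measurable]: "p \<sigma> \<in> borel_measurable R" for \<sigma>
    unfolding p_def by measurable
  have cpm: "max (c \<omega>) 0 - max (- c \<omega>) 0 = c \<omega>" for \<omega> by auto
  have intp: "integrable R (\<lambda>\<omega>. max (c \<omega>) 0)" "integrable R (\<lambda>\<omega>. max (- c \<omega>) 0)"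
    using c by auto
  have "(\<integral>\<omega>. c \<omega> \<partial>R) = 0"
    using null[of "{}" "{\<lambda>_. undefined}"] by (simp add: PiM_empty restrict_def)
  then have m': "(\<integral>\<omega>. max (- c \<omega>) 0 \<partial>R) = m"
    unfolding m_def using Bochner_Integration.integral_diff[OF intp] by (simp add: cpm)
  have "m \<noteq> 0"
  proof
    assume m0: "m = 0"
    have "AE \<omega> in R. 0 \<le> max (c \<omega>) 0" "AE \<omega> in R. 0 \<le> max (- c \<omega>) 0" by auto
    then have "AE \<omega> in R. max (c \<omega>) 0 = 0" "AE \<omega> in R. max (- c \<omega>) 0 = 0"
      using integral_nonneg_eq_0_iff_AE[OF intp(1)] integral_nonneg_eq_0_iff_AE[OF intp(2)] m0 m'
      unfolding m_def by metis+
    then have "AE \<omega> in R. c \<omega> * s \<omega> = 0"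
      by eventually_elim (auto simp: max_def split: if_splits)
    then have "(\<integral>\<omega>. c \<omega> * s \<omega> \<partial>R) = 0" by (rule integral_eq_zero_AE)
    then show False using nonzero by (simp add: s_def)
  qed
  moreover have "m \<ge> 0" unfolding m_def by (rule Bochner_Integration.integral_nonneg) auto
  ultimately have m: "m > 0" by simp
  have p_nonneg: "p \<sigma> \<omega> \<ge> 0" for \<sigma> \<omega> using m by (simp add: p_def)
  have p_int: "integrable R (p \<sigma>)" for \<sigma> unfolding p_def using c by auto
  have p_diff: "p 1 \<omega> - p (-1) \<omega> = c \<omega> / m" for \<omega>
    unfolding p_def using cpm[of \<omega>] by (simp add: diff_divide_distrib[symmetric])
  define P where "P \<sigma> = density R (\<lambda>\<omega>. ennreal (p \<sigma> \<omega>))" for \<sigma>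
  have emeasure_P: "emeasure (P \<sigma>) A = ennreal (\<integral>\<omega>. p \<sigma> \<omega> * indicator A \<omega> \<partial>R)"
    if [measurable]: "A \<in> sets R" for \<sigma> A
  proof -
    have "emeasure (P \<sigma>) A = (\<integral>\<^sup>+\<omega>. ennreal (p \<sigma> \<omega> * indicator A \<omega>) \<partial>R)"
      unfolding P_def by (subst emeasure_density) (auto intro!: nn_integral_cong split: split_indicator)
    also have "\<dots> = ennreal (\<integral>\<omega>. p \<sigma> \<omega> * indicator A \<omega> \<partial>R)"
      by (rule nn_integral_eq_integral) (auto intro!: integrable_real_mult_indicator p_int simp: p_nonneg)
    finally show ?thesis .
  qed
  have space_P: "emeasure (P \<sigma>) (space (P \<sigma>)) = ennreal (\<integral>\<omega>. p \<sigma> \<omega> \<partial>R)" for \<sigma>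
    using emeasure_P[of "space R" \<sigma>]
    by (simp add: P_def cong: Bochner_Integration.integral_cong)
  have prob: "prob_space (P \<sigma>)" if "\<sigma> \<in> {1, -1}" for \<sigma>
    using that m m' by (intro prob_spaceI) (auto simp: space_P p_def m_def[symmetric])
  have rv: "random_vector n (P \<sigma>) Z" if "\<sigma> \<in> {1, -1}" for \<sigma>
    using that prob Z unfolding random_vector_def P_def by auto
  have marg: "marginal (P 1) Z S = marginal (P (-1)) Z S" if S: "S \<subseteq> {1..n}" "card S \<le> k" for S
  proof (rule measure_eqI)
    fix B assume "B \<in> sets (marginal (P 1) Z S)"
    then have B: "B \<in> sets (Pi\<^sub>M S (\<lambda>_. borel))" by (simp add: marginal_def)
    define A where "A = (\<lambda>\<omega>. \<lambda>i\<in>S. Z i \<omega>) -` B \<inter> space R"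
    have F: "(\<lambda>\<omega>. \<lambda>i\<in>S. Z i \<omega>) \<in> measurable R (Pi\<^sub>M S (\<lambda>_. borel))"
      using S by (intro measurable_restrict Z) auto
    then have A: "A \<in> sets R" unfolding A_def using B by (rule measurable_sets)
    have em: "emeasure (marginal (P \<sigma>) Z S) B = ennreal (\<integral>\<omega>. p \<sigma> \<omega> * indicator A \<omega> \<partial>R)" for \<sigma>
      unfolding marginal_def emeasure_P[OF A, symmetric] using F B
      by (subst emeasure_distr) (auto simp: P_def A_def)
    have "(\<integral>\<omega>. p 1 \<omega> * indicator A \<omega> \<partial>R) - (\<integral>\<omega>. p (-1) \<omega> * indicator A \<omega> \<partial>R) =
        (\<integral>\<omega>. p 1 \<omega> * indicator A \<omega> - p (-1) \<omega> * indicator A \<omega> \<partial>R)"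
      using A by (intro Bochner_Integration.integral_diff[symmetric] integrable_real_mult_indicator p_int)
    also have "\<dots> = (\<integral>\<omega>. (c \<omega> * indicator B (\<lambda>i\<in>S. Z i \<omega>)) / m \<partial>R)"
      by (intro Bochner_Integration.integral_cong refl)
        (auto simp: left_diff_distrib[symmetric] p_diff A_def split: split_indicator)
    also have "\<dots> = 0" using null[OF S B] by simp
    finally show "emeasure (marginal (P 1) Z S) B = emeasure (marginal (P (-1)) Z S) B"
      unfolding em by simp
  qed (simp add: marginal_def)
  have ints: "integrable R (\<lambda>\<omega>. p \<sigma> \<omega> * s \<omega>)" if "\<sigma> \<in> {1, -1}" for \<sigma>
  proof (rule Bochner_Integration.integrable_bound)
    show "integrable R (\<lambda>\<omega>. c \<omega> * s \<omega> / m)" using int by (simp add: s_def)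
    have "\<bar>max (\<sigma> * c \<omega>) 0\<bar> \<le> \<bar>c \<omega>\<bar>" for \<omega> using that by auto
    then show "AE \<omega> in R. norm (p \<sigma> \<omega> * s \<omega>) \<le> norm (c \<omega> * s \<omega> / m)"
      using m by (auto simp: p_def abs_mult intro!: divide_right_mono mult_right_mono)
  qed measurable
  have int_P: "integrable (P \<sigma>) s" "(\<integral>\<omega>. s \<omega> \<partial>P \<sigma>) = (\<integral>\<omega>. p \<sigma> \<omega> * s \<omega> \<partial>R)" if "\<sigma> \<in> {1, -1}" for \<sigma>
    unfolding P_def using ints[OF that] p_nonneg by (auto simp: integrable_density integral_density)
  have "(\<integral>\<omega>. p 1 \<omega> * s \<omega> \<partial>R) - (\<integral>\<omega>. p (-1) \<omega> * s \<omega> \<partial>R) = (\<integral>\<omega>. p 1 \<omega> * s \<omega> - p (-1) \<omega> * s \<omega> \<partial>R)"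
    by (intro Bochner_Integration.integral_diff[symmetric] ints) auto
  also have "\<dots> = (\<integral>\<omega>. c \<omega> * s \<omega> \<partial>R) / m"
    by (simp add: left_diff_distrib[symmetric] p_diff)
  also have "\<dots> \<noteq> 0" using nonzero m by (simp add: s_def)
  finally have "(\<integral>\<omega>. s \<omega> \<partial>P 1) \<noteq> (\<integral>\<omega>. s \<omega> \<partial>P (-1))" by (simp add: int_P)
  moreover have "extended_expectation (P 1) s = extended_expectation (P (-1)) s"
  proof -
    have s_eq: "s = (\<lambda>\<omega>. \<Sum>i=1..n. Z i \<omega>)" by (simp add: s_def fun_eq_iff)
    have "expectation_defined (P \<sigma>) s" if "\<sigma> \<in> {1, -1}" for \<sigma>
      using that by (intro extended_expectation_integrable(1) int_P(1))
    note def = this[unfolded s_eq]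
    show ?thesis
      unfolding s_eq
      by (rule determined_by_marginalsD[OF det rv[of 1] rv[of "-1"] marg def[of 1] def[of "-1"]]) auto
  qed
  ultimately show False by (simp add: extended_expectation_integrable int_P)
qed

lemma count_space_Sigma_nat:
  fixes g :: "nat \<times> nat \<Rightarrow> real"
  assumes "summable (\<lambda>j. \<Sum>i<len j. \<bar>g (j, i)\<bar>)"
  shows "integrable (count_space (Sigma UNIV (\<lambda>j. {..<len j}))) g"
    and "(\<integral>z. g z \<partial>count_space (Sigma UNIV (\<lambda>j. {..<len j}))) = (\<Sum>j. \<Sum>i<len j. g (j, i))"
proof -
  have sm: "Infinite_Set_Sum.abs_summable_on g (Sigma UNIV (\<lambda>j. {..<len j}))"
    using assms
    by (subst Infinite_Set_Sum.abs_summable_on_Sigma_iff)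
      (auto simp: Infinite_Set_Sum.abs_summable_on_nat_iff' abs_of_nonneg sum_nonneg)
  then show "integrable (count_space (Sigma UNIV (\<lambda>j. {..<len j}))) g"
    by (simp add: Infinite_Set_Sum.abs_summable_on_def)
  have "summable (\<lambda>j. norm (\<Sum>i<len j. g (j, i)))"
    by (rule summable_comparison_test'[OF assms, of 0]) (auto intro: order_trans[OF sum_abs])
  then have "infsetsum g (Sigma UNIV (\<lambda>j. {..<len j})) = (\<Sum>j. \<Sum>i<len j. g (j, i))"
    using sm
    by (subst infsetsum_Sigma) (auto intro!: infsetsum_nat' simp: Infinite_Set_Sum.abs_summable_on_nat_iff')
  then show "(\<integral>z. g z \<partial>count_space (Sigma UNIV (\<lambda>j. {..<len j}))) = (\<Sum>j. \<Sum>i<len j. g (j, i))"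
    by (simp add: infsetsum_def)
qed

text \<open>
  The signed measure is \<open>u\<close> minus the series of dilates of \<open>h\<close>. Its index set consists of the pairs
  \<open>(0, i)\<close> for the atoms of \<open>u\<close> and \<open>(Suc j, i)\<close> for the atoms of \<open>h\<close> dilated by \<open>(- 2) ^ j\<close>. At an
  index of the second kind the sum of the coordinates is 0.
\<close>

lemma not_determined_below_half:
  assumes k: "1 \<le> k" and n: "2 * k + 1 \<le> n"
  shows "\<not> determined_by_marginals n k"
proof -
  let ?U = "{1..n}"
  obtain u h where u: "finitary UNIV u" and h: "finitary {x. (\<Sum>i\<in>?U. x i) = 0} h"
    and u_sum: "u (\<lambda>x. real_of_int (\<Sum>i\<in>?U. x i)) = 1"
    and rel: "\<And>S \<phi>. S \<subseteq> ?U \<Longrightarrow> card S \<le> k \<Longrightarrow> depends_on S \<phi> \<Longrightarrow>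
       h \<phi> = 2 * u \<phi> + u (\<lambda>x. \<phi> (\<lambda>i. - 2 * x i))"
    using dilation_relation[of ?U k] k n by auto
  obtain ps where "set ps \<subseteq> UNIV \<times> UNIV"
    and u_eq: "\<And>\<phi>. u \<phi> = (\<Sum>i<length ps. fst (ps ! i) * \<phi> (snd (ps ! i)))"
    by (rule finitary_atoms[OF u]) (rule that)
  obtain qs where qs: "set qs \<subseteq> UNIV \<times> {x. (\<Sum>i\<in>?U. x i) = 0}"
    and h_eq: "\<And>\<phi>. h \<phi> = (\<Sum>i<length qs. fst (qs ! i) * \<phi> (snd (qs ! i)))"
    by (rule finitary_atoms[OF h]) (rule that)
  define len where "len = case_nat (length ps) (\<lambda>_. length qs)"
  define c where "c = (\<lambda>(j, i). case j of 0 \<Rightarrow> fst (ps ! i) | Suc j' \<Rightarrow> - (1/2 * (- 1/2) ^ j' * fst (qs ! i)))"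
  define pt where "pt = (\<lambda>(j, i). case j of 0 \<Rightarrow> snd (ps ! i) | Suc j' \<Rightarrow> \<lambda>a. (- 2) ^ j' * snd (qs ! i) a)"
  define R where "R = count_space (Sigma UNIV (\<lambda>j. {..<len j}))"
  have level_0: "(\<Sum>i<len 0. c (0, i) * \<phi> (pt (0, i))) = u \<phi>" for \<phi>
    by (simp add: u_eq len_def c_def pt_def)
  have level_Suc: "(\<Sum>i<len (Suc j). c (Suc j, i) * \<phi> (pt (Suc j, i))) =
      - (1/2 * (- 1/2) ^ j * h (\<lambda>x. \<phi> (\<lambda>a. (- 2) ^ j * x a)))" for \<phi> j
    by (simp add: h_eq len_def c_def pt_def sum_distrib_left sum_negf mult.assoc)
  have sum_pt: "(\<Sum>a\<in>?U. pt (Suc j, i) a) = 0" if "i < len (Suc j)" for i j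
  proof -
    have "i < length qs" using that by (simp add: len_def)
    then have "qs ! i \<in> UNIV \<times> {x. (\<Sum>a\<in>?U. x a) = 0}" using qs nth_mem by blast
    then have "(\<Sum>a\<in>?U. snd (qs ! i) a) = 0" by (simp add: mem_Times_iff)
    then show ?thesis by (simp add: pt_def sum_distrib_left[symmetric])
  qed
  have summable_c: "summable (\<lambda>j. \<Sum>i<len j. \<bar>c (j, i)\<bar>)"
  proof (subst summable_Suc_iff[symmetric])
    have "(\<Sum>i<len (Suc j). \<bar>c (Suc j, i)\<bar>) = (1/2) ^ j * (1/2 * (\<Sum>i<length qs. \<bar>fst (qs ! i)\<bar>))" for j
      by (simp add: len_def c_def abs_mult power_abs sum_distrib_left mult.assoc)
    then show "summable (\<lambda>j. \<Sum>i<len (Suc j). \<bar>c (Suc j, i)\<bar>)"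
      by (simp only:) (intro summable_mult2 summable_geometric, simp)
  qed
  have test: "(\<integral>z. c z * \<phi> (pt z) \<partial>R) = 0"
    if S: "S \<subseteq> ?U" "card S \<le> k" and \<phi>: "depends_on S \<phi>" "\<And>x. \<bar>\<phi> x\<bar> \<le> 1" for S \<phi>
  proof -
    have "summable (\<lambda>j. \<Sum>i<len j. \<bar>c (j, i) * \<phi> (pt (j, i))\<bar>)"
      using mult_left_mono[OF \<phi>(2) abs_ge_zero]
      by (intro summable_comparison_test'[OF summable_c, of 0])
        (auto simp: abs_mult sum_nonneg intro!: sum_mono)
    then have "(\<integral>z. c z * \<phi> (pt z) \<partial>R) = (\<Sum>j. \<Sum>i<len j. c (j, i) * \<phi> (pt (j, i)))"
      unfolding R_def by (rule count_space_Sigma_nat)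
    moreover have "(\<lambda>j. \<Sum>i<len j. c (j, i) * \<phi> (pt (j, i))) sums (- u \<phi> + u \<phi>)"
    proof (subst level_0[symmetric], rule sums_Suc)
      have "\<bar>u \<psi>\<bar> \<le> (\<Sum>i<length ps. \<bar>fst (ps ! i)\<bar>)" if "\<And>x. \<bar>\<psi> x\<bar> \<le> 1" for \<psi>
        unfolding u_eq using mult_left_mono[OF that abs_ge_zero]
        by (intro order_trans[OF sum_abs] sum_mono) (auto simp: abs_mult)
      from sums_minus[OF dilation_series[OF rel[OF S] this \<phi>]]
      show "(\<lambda>j. \<Sum>i<len (Suc j). c (Suc j, i) * \<phi> (pt (Suc j, i))) sums - u \<phi>"
        unfolding level_Suc .
    qed
    ultimately show ?thesis by (simp add: sums_iff)
  qed
  define s where "s z = (\<Sum>a=1..n. real_of_int (pt z a))" for z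
  have s_Suc: "s (Suc j, i) = 0" if "i < len (Suc j)" for i j
    using sum_pt[OF that] unfolding s_def by (metis of_int_0 of_int_sum)
  have lev_s: "(\<Sum>i<len (Suc j). \<bar>c (Suc j, i) * s (Suc j, i)\<bar>) = 0" "(\<Sum>i<len (Suc j). c (Suc j, i) * s (Suc j, i)) = 0" for j
    using s_Suc by auto
  have sm: "summable (\<lambda>j. \<Sum>i<len j. \<bar>c (j, i) * s (j, i)\<bar>)"
    by (subst summable_Suc_iff[symmetric]) (simp add: lev_s)
  have "(\<integral>z. c z * s z \<partial>R) = (\<Sum>j. \<Sum>i<len j. c (j, i) * s (j, i))"
    unfolding R_def by (rule count_space_Sigma_nat[OF sm])
  also have "\<dots> = (\<Sum>j\<in>{0}. \<Sum>i<len j. c (j, i) * s (j, i))"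
  proof (rule suminf_finite)
    fix j :: nat assume "j \<notin> {0}"
    then obtain j' where "j = Suc j'" by (cases j) auto
    then show "(\<Sum>i<len j. c (j, i) * s (j, i)) = 0" using lev_s by simp
  qed simp
  also have "\<dots> = u (\<lambda>x. real_of_int (\<Sum>i\<in>?U. x i))"
    by (subst level_0[symmetric]) (simp add: s_def)
  finally have int_s: "(\<integral>z. c z * s z \<partial>R) = 1" using u_sum by simp
  show ?thesis
  proof (rule not_determined_by_marginalsI)
    show "integrable R c"
      unfolding R_def by (rule count_space_Sigma_nat[OF summable_c])
    show "(\<lambda>z. real_of_int (pt z i)) \<in> borel_measurable R" for i
      by (simp add: R_def)
    show "integrable R (\<lambda>z. c z * (\<Sum>i=1..n. real_of_int (pt z i)))"
      using count_space_Sigma_nat(1)[OF sm] by (simp add: R_def s_def)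
    show "(\<integral>z. c z * (\<Sum>i=1..n. real_of_int (pt z i)) \<partial>R) \<noteq> 0"
      using int_s by (simp add: s_def)
  next
    fix S B assume S: "S \<subseteq> ?U" "card S \<le> k"
    show "(\<integral>z. c z * indicator B (\<lambda>i\<in>S. real_of_int (pt z i)) \<partial>R) = 0"
    proof (rule test[OF S, where \<phi> = "\<lambda>x. indicator B (\<lambda>i\<in>S. real_of_int (x i))"])
      show "depends_on S (\<lambda>x. indicator B (\<lambda>i\<in>S. real_of_int (x i)))"
        unfolding depends_on_def
      proof (intro allI impI)
        fix x y :: "nat \<Rightarrow> int" assume "\<forall>i\<in>S. x i = y i"
        then have "(\<lambda>i\<in>S. real_of_int (x i)) = (\<lambda>i\<in>S. real_of_int (y i))" by (auto simp: fun_eq_iff)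
        then show "indicator B (\<lambda>i\<in>S. real_of_int (x i)) = (indicator B (\<lambda>i\<in>S. real_of_int (y i)) :: real)" by simp
      qed
    qed (simp split: split_indicator)
  qed
qed

section \<open>The marginal degree\<close>

theorem theorem1:
  fixes n :: nat
  assumes "n \<ge> 2"
  shows "int (marginal_degree n) = \<lceil>real n / 2\<rceil>"
proof -
  define k where "k = (n + 1) div 2"
  have k: "1 \<le> k" "k \<le> n" "n \<le> 2 * k" "2 * k \<le> n + 1"
    using assms by (auto simp: k_def)
  have "marginal_degree n = k"
    unfolding marginal_degree_def
  proof (rule Least_equality)
    show "1 \<le> k \<and> k \<le> n \<and> determined_by_marginals n k"
      using k determined_by_half_marginals by blast
    fix j assume j: "1 \<le> j \<and> j \<le> n \<and> determined_by_marginals n j"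
    show "k \<le> j"
    proof (rule ccontr)
      assume "\<not> k \<le> j"
      then have "1 \<le> j" "2 * j + 1 \<le> n" using j k by auto
      then show False using not_determined_below_half j by blast
    qed
  qed
  moreover have "\<lceil>real n / 2\<rceil> = int k"
    using k by (intro ceiling_unique) auto
  ultimately show ?thesis by simp
qed

end
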